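(* Let $d\geqslant 3$, $n\in\{2d,2d+1\}$, $\varepsilon\in\mathbb{F}_2$, and let $\Gamma=\frac12H(n,2)$ be the halved cube with vertex set $X=X_n^{\varepsilon}$. Let $Y$ be a nontrivial descendent of $\Gamma$ (with respect to the standard $Q$-polynomial ordering) with width $w$. Then $n=2d$ and one of the following holds: (i) $w=1$ and $Y=\{x\in X:\mathrm{wt}(x-z)=1\}$ for some $z\in X_n^{1+\varepsilon}=\mathbb{F}_2^n\setminus X$; (ii) $w=d-1$ and there are $a\in\mathbb{F}_2$ and $i\in\{1,2,\dots,n\}$ such that $Y=\{x=(\xi_1,\xi_2,\dots,\xi_n)\in X:\xi_i=a\}$.
   Context: All graphs are finite, simple and undirected. Let $\Gamma$ be a connected graph with vertex set $X$, path-length distance $\partial$ and diameter $d$; let $A_i\in\mathbb{C}^{X\times X}$ be the adjacency matrix of the distance-$i$ graph ($A_0=I$). $\Gamma$ is distance-regular if there are integers $b_i,c_i$ such that whenever $\partial(x,y)=i$, $y$ has exactly $b_i$ (resp. $c_i$) neighbours at distance $i+1$ (resp. $i-1$) from $x$. Then the Bose--Mesner algebra $\langle A_0,\dots,A_d\rangle$ (complex span) is a commutative semisimple algebra with a basis of primitive idempotents $E_0=|X|^{-1}J,E_1,\dots,E_d$. $\Gamma$ is $Q$-polynomial with respect to the ordering $\{E_i\}_{i=0}^d$ if there are scalars $a_i^*,b_i^*,c_i^*$ with $b_d^*=c_0^*=0$, $b_{i-1}^*c_i^*\neq 0$ $(1\leqslant i\leqslant d)$ and $E_1\circ E_i=|X|^{-1}(b_{i-1}^*E_{i-1}+a_i^*E_i+c_{i+1}^*E_{i+1})$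 $(0\leqslant i\leqslant d)$, where $\circ$ is the entrywise product, $E_{-1}=E_{d+1}=0$, $b_{-1}^*=c_{d+1}^*=0$. Write $|X|E_1=\sum_{i=0}^d\theta_i^*A_i$. For a nonempty $Y\subseteq X$ with characteristic vector $\hat Y$, the width is $w=\max\{i:\hat Y^{\mathsf T}A_i\hat Y\neq 0\}$ and the dual width is $w^*=\max\{i:\hat Y^{\mathsf T}E_i\hat Y\neq 0\}$. One always has $w+w^*\geqslant d$; $Y$ is a descendent of $\Gamma$ if $w+w^*=d$; it is trivial if moreover $w=0$ or $w=d$ (a singleton or $X$), nontrivial otherwise. Put $[i]_q=1+q+\dots+q^{i-1}$. $\Gamma$ has classical parameters $(d,q,\alpha,\beta)$ if $b_i=([d]_q-[i]_q)(\beta-\alpha[i]_q)$ and $c_i=[i]_q(1+\alpha[i-1]_q)$ for $0\leqslant i\leqslant d$. Then $\Gamma$ has a $Q$-polynomial ordering, called standard, for which $\theta_i^*=\xi^*[d-i]_q+\zeta^*$ for some scalars $\xi^*\neq 0$, $\zeta^*$. $\mathrm{wt}(x)$ is the Hamming weight of $x\in\mathbb{F}_2^n$; $X_n^0$ (resp. $X_n^1$) is the set of even- (resp. odd-)weight vectors of $\mathbb{F}_2^n$. In $\frac12H(n,2)$, $x,y\in X_n^{\varepsilon}$ are adjacent if $\mathrm{wt}(x-y)=2$. It is distance-regular with diameter $d$ and classical parameters $(d,1,2,m)$, where $m=2d-1$ if $n=2d$ and $m=2d+1$ if $n=2d+1$. *)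

theory Defs
  imports "HOL-Analysis.Finite_Cartesian_Product" "HOL-Library.Indicator_Function"
    "HOL-Library.Z2"
begin

section \<open>Distance-regular graphs\<close>

text \<open>A graph is a vertex set \<open>V\<close> with an adjacency relation \<open>adj\<close>.\<close>

definition simple_graph :: "'a set \<Rightarrow> ('a \<Rightarrow> 'a \<Rightarrow> bool) \<Rightarrow> bool" where
  "simple_graph V adj \<longleftrightarrow> finite V \<and>
     (\<forall>x y. adj x y \<longrightarrow> x \<in> V \<and> y \<in> V \<and> x \<noteq> y \<and> adj y x)"

definition connected_graph :: "'a set \<Rightarrow> ('a \<Rightarrow> 'a \<Rightarrow> bool) \<Rightarrow> bool" where
  "connected_graph V adj \<longleftrightarrow> simple_graph V adj \<and> V \<noteq> {} \<and>
     (\<forall>x\<in>V. \<forall>y\<in>V. \<exists>k. (adj ^^ k) x y)"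

definition gdist :: "('a \<Rightarrow> 'a \<Rightarrow> bool) \<Rightarrow> 'a \<Rightarrow> 'a \<Rightarrow> nat" where
  "gdist adj x y = (LEAST k. (adj ^^ k) x y)"

definition diam :: "'a set \<Rightarrow> ('a \<Rightarrow> 'a \<Rightarrow> bool) \<Rightarrow> nat" where
  "diam V adj = Max {gdist adj x y | x y. x \<in> V \<and> y \<in> V}"

definition intersection_numbers ::
    "'a set \<Rightarrow> ('a \<Rightarrow> 'a \<Rightarrow> bool) \<Rightarrow> (nat \<Rightarrow> nat) \<Rightarrow> (nat \<Rightarrow> nat) \<Rightarrow> bool" where
  "intersection_numbers V adj b c \<longleftrightarrow>
     (\<forall>x\<in>V. \<forall>y\<in>V. \<forall>i. gdist adj x y = i \<longrightarrow>
        card {z \<in> V. adj y z \<and> gdist adj x z = i + 1} = b i \<and>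
        card {z \<in> V. adj y z \<and> gdist adj x z + 1 = i} = c i)"

definition distance_regular :: "'a set \<Rightarrow> ('a \<Rightarrow> 'a \<Rightarrow> bool) \<Rightarrow> bool" where
  "distance_regular V adj \<longleftrightarrow>
     connected_graph V adj \<and> (\<exists>b c. intersection_numbers V adj b c)"

definition q_int :: "real \<Rightarrow> nat \<Rightarrow> real" where
  "q_int q i = (\<Sum>j<i. q ^ j)"

definition classical_parameters ::
    "'a set \<Rightarrow> ('a \<Rightarrow> 'a \<Rightarrow> bool) \<Rightarrow> nat \<Rightarrow> real \<Rightarrow> real \<Rightarrow> real \<Rightarrow> bool" where
  "classical_parameters V adj d q \<alpha> \<beta> \<longleftrightarrow>
     connected_graph V adj \<and> diam V adj = d \<and>
     (\<exists>b c. intersection_numbers V adj b c \<and>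
        (\<forall>i\<le>d. real (b i) = (q_int q d - q_int q i) * (\<beta> - \<alpha> * q_int q i) \<and>
                real (c i) = q_int q i * (1 + \<alpha> * q_int q (i - 1))))"

section \<open>The Bose--Mesner algebra and Q-polynomial orderings\<close>

text \<open>A matrix with rows and columns indexed by \<open>V\<close> is a function of two arguments that
  vanishes outside \<open>V \<times> V\<close>; thus equality of matrices is equality of functions.\<close>

type_synonym 'a matrix = "'a \<Rightarrow> 'a \<Rightarrow> complex"

definition dist_matrix :: "'a set \<Rightarrow> ('a \<Rightarrow> 'a \<Rightarrow> bool) \<Rightarrow> nat \<Rightarrow> 'a matrix" where
  "dist_matrix V adj i = (\<lambda>x y. if x \<in> V \<and> y \<in> V \<and> gdist adj x y = i then 1 else 0)"

definition mat_mult :: "'a set \<Rightarrow> 'a matrix \<Rightarrow> 'a matrix \<Rightarrow> 'a matrix" where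
  "mat_mult V M N = (\<lambda>x y. \<Sum>z\<in>V. M x z * N z y)"

definition bose_mesner :: "'a set \<Rightarrow> ('a \<Rightarrow> 'a \<Rightarrow> bool) \<Rightarrow> 'a matrix set" where
  "bose_mesner V adj =
     {\<lambda>x y. \<Sum>i\<le>diam V adj. k i * dist_matrix V adj i x y | k :: nat \<Rightarrow> complex. True}"

definition idempotents :: "'a set \<Rightarrow> ('a \<Rightarrow> 'a \<Rightarrow> bool) \<Rightarrow> 'a matrix set" where
  "idempotents V adj = {M \<in> bose_mesner V adj. mat_mult V M M = M}"

definition primitive_idempotents :: "'a set \<Rightarrow> ('a \<Rightarrow> 'a \<Rightarrow> bool) \<Rightarrow> 'a matrix set" where
  "primitive_idempotents V adj =
     {M \<in> idempotents V adj. M \<noteq> (\<lambda>x y. 0) \<and>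
        \<not> (\<exists>F \<in> idempotents V adj. \<exists>G \<in> idempotents V adj.
             F \<noteq> (\<lambda>x y. 0) \<and> G \<noteq> (\<lambda>x y. 0) \<and>
             mat_mult V F G = (\<lambda>x y. 0) \<and> mat_mult V G F = (\<lambda>x y. 0) \<and>
             M = (\<lambda>x y. F x y + G x y))}"

text \<open>\<open>E 0, \<dots>, E d\<close> lists each primitive idempotent exactly once, starting with
  \<open>|V|\<^sup>-\<^sup>1 J\<close>. The values \<open>E i\<close> for \<open>i > d\<close> are irrelevant.\<close>

definition idempotent_ordering ::
    "'a set \<Rightarrow> ('a \<Rightarrow> 'a \<Rightarrow> bool) \<Rightarrow> (nat \<Rightarrow> 'a matrix) \<Rightarrow> bool" where
  "idempotent_ordering V adj E \<longleftrightarrow>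
     bij_betw E {0..diam V adj} (primitive_idempotents V adj) \<and>
     E 0 = (\<lambda>x y. if x \<in> V \<and> y \<in> V then 1 / of_nat (card V) else 0)"

text \<open>The conditionals implement \<open>E\<^sub>-\<^sub>1 = E\<^sub>d\<^sub>+\<^sub>1 = 0\<close>.\<close>

definition Q_polynomial ::
    "'a set \<Rightarrow> ('a \<Rightarrow> 'a \<Rightarrow> bool) \<Rightarrow> (nat \<Rightarrow> 'a matrix) \<Rightarrow> bool" where
  "Q_polynomial V adj E \<longleftrightarrow>
     distance_regular V adj \<and> idempotent_ordering V adj E \<and>
     (\<exists>as bs cs :: nat \<Rightarrow> complex.
        bs (diam V adj) = 0 \<and> cs 0 = 0 \<and>
        (\<forall>i\<in>{1..diam V adj}. bs (i - 1) * cs i \<noteq> 0) \<and>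
        (\<forall>i\<le>diam V adj. \<forall>x\<in>V. \<forall>y\<in>V.
           E 1 x y * E i x y = 1 / of_nat (card V) *
             ((if i = 0 then 0 else bs (i - 1) * E (i - 1) x y)
              + as i * E i x y
              + (if i = diam V adj then 0 else cs (i + 1) * E (i + 1) x y))))"

definition dual_eigenvalues ::
    "'a set \<Rightarrow> ('a \<Rightarrow> 'a \<Rightarrow> bool) \<Rightarrow> (nat \<Rightarrow> 'a matrix) \<Rightarrow> (nat \<Rightarrow> complex) \<Rightarrow> bool" where
  "dual_eigenvalues V adj E \<theta> \<longleftrightarrow>
     (\<forall>x\<in>V. \<forall>y\<in>V. of_nat (card V) * E 1 x y =
        (\<Sum>i\<le>diam V adj. \<theta> i * dist_matrix V adj i x y))"

definition standard_ordering ::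
    "'a set \<Rightarrow> ('a \<Rightarrow> 'a \<Rightarrow> bool) \<Rightarrow> nat \<Rightarrow> real \<Rightarrow> real \<Rightarrow> real \<Rightarrow> (nat \<Rightarrow> 'a matrix) \<Rightarrow> bool" where
  "standard_ordering V adj d q \<alpha> \<beta> E \<longleftrightarrow>
     classical_parameters V adj d q \<alpha> \<beta> \<and> Q_polynomial V adj E \<and>
     (\<exists>\<theta> \<xi> \<zeta>. dual_eigenvalues V adj E \<theta> \<and> \<xi> \<noteq> 0 \<and>
        (\<forall>i\<le>d. \<theta> i = \<xi> * of_real (q_int q (d - i)) + \<zeta>))"

section \<open>Width, dual width and descendents\<close>

definition quad_form :: "'a set \<Rightarrow> 'a matrix \<Rightarrow> 'a set \<Rightarrow> complex" where
  "quad_form V M Y = (\<Sum>x\<in>V. \<Sum>y\<in>V. indicator Y x * M x y * indicator Y y)"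

definition width :: "'a set \<Rightarrow> ('a \<Rightarrow> 'a \<Rightarrow> bool) \<Rightarrow> 'a set \<Rightarrow> nat" where
  "width V adj Y = Max {i. i \<le> diam V adj \<and> quad_form V (dist_matrix V adj i) Y \<noteq> 0}"

definition dual_width ::
    "'a set \<Rightarrow> ('a \<Rightarrow> 'a \<Rightarrow> bool) \<Rightarrow> (nat \<Rightarrow> 'a matrix) \<Rightarrow> 'a set \<Rightarrow> nat" where
  "dual_width V adj E Y = Max {i. i \<le> diam V adj \<and> quad_form V (E i) Y \<noteq> 0}"

definition descendent ::
    "'a set \<Rightarrow> ('a \<Rightarrow> 'a \<Rightarrow> bool) \<Rightarrow> (nat \<Rightarrow> 'a matrix) \<Rightarrow> 'a set \<Rightarrow> bool" where
  "descendent V adj E Y \<longleftrightarrow>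
     Y \<noteq> {} \<and> Y \<subseteq> V \<and> width V adj Y + dual_width V adj E Y = diam V adj"

definition nontrivial_descendent ::
    "'a set \<Rightarrow> ('a \<Rightarrow> 'a \<Rightarrow> bool) \<Rightarrow> (nat \<Rightarrow> 'a matrix) \<Rightarrow> 'a set \<Rightarrow> bool" where
  "nontrivial_descendent V adj E Y \<longleftrightarrow>
     descendent V adj E Y \<and> width V adj Y \<noteq> 0 \<and> width V adj Y \<noteq> diam V adj"

section \<open>Halved cubes\<close>

text \<open>\<open>bit\<close> is the field with two elements; the index type \<open>'n\<close> plays the role of
  \<open>{1, \<dots>, n}\<close>, with \<open>n = CARD('n)\<close>.\<close>

definition wt :: "bit ^ 'n \<Rightarrow> nat" where
  "wt x = card {i. x $ i \<noteq> 0}"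

definition halved_cube_vertices :: "bit \<Rightarrow> (bit ^ 'n) set" where
  "halved_cube_vertices \<epsilon> = {x. even (wt x) \<longleftrightarrow> \<epsilon> = 0}"

definition halved_cube_adj :: "bit \<Rightarrow> bit ^ 'n \<Rightarrow> bit ^ 'n \<Rightarrow> bool" where
  "halved_cube_adj \<epsilon> x y \<longleftrightarrow>
     x \<in> halved_cube_vertices \<epsilon> \<and> y \<in> halved_cube_vertices \<epsilon> \<and> wt (x - y) = 2"

text \<open>The halved cube does have the classical parameters used to single out its
  standard ordering.\<close>

definition diff_set :: "bit ^ 'n \<Rightarrow> bit ^ 'n \<Rightarrow> 'n set" where
  "diff_set x y = {i. x $ i \<noteq> y $ i}"

definition flip :: "bit ^ 'n \<Rightarrow> 'n set \<Rightarrow> bit ^ 'n" where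
  "flip x S = (\<chi> i. if i \<in> S then x $ i + 1 else x $ i)"

lemma wt_diff: "wt (x - y) = card (diff_set x y)"
proof -
  have "(x - y) $ i \<noteq> 0 \<longleftrightarrow> x $ i \<noteq> y $ i" for i
    by (cases "x $ i"; cases "y $ i") auto
  then show ?thesis by (simp only: wt_def diff_set_def)
qed

lemma wt_diff_set: "wt x = card (diff_set x 0)"
  by (simp add: wt_def diff_set_def)

lemma bit_neq_trans: "(a::bit) \<noteq> c \<longleftrightarrow> (a \<noteq> b) \<noteq> (b \<noteq> c)"
  by (cases a; cases b; cases c) auto

lemma diff_set_sym_diff: "diff_set x z = sym_diff (diff_set x y) (diff_set y z)"
proof (rule set_eqI)
  fix i
  show "i \<in> diff_set x z \<longleftrightarrow> i \<in> sym_diff (diff_set x y) (diff_set y z)"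
    using bit_neq_trans[of "x $ i" "z $ i" "y $ i"] by (auto simp: diff_set_def)
qed

lemma diff_set_commute: "diff_set x y = diff_set y x"
  by (auto simp: diff_set_def)

lemma diff_set_flip: "diff_set x (flip x S) = S"
proof -
  have "b + 1 \<noteq> b" for b :: bit by (cases b) auto
  then show ?thesis by (auto simp: diff_set_def flip_def)
qed

lemma flip_diff_set: "flip x (diff_set x y) = y"
proof -
  have "a \<noteq> b \<Longrightarrow> a + 1 = b" for a b :: bit by (cases a; cases b) auto
  then show ?thesis by (auto simp: diff_set_def flip_def vec_eq_iff)
qed

lemma diff_set_empty: "diff_set x y = {} \<longleftrightarrow> x = y"
  by (auto simp: diff_set_def vec_eq_iff)

lemma card_sym_diff:
  assumes "finite A" "finite B"
  shows "card (sym_diff A B) + 2 * card (A \<inter> B) = card A + card B"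
proof -
  have "card (sym_diff A B) = card (A - B) + card (B - A)"
    using assms by (intro card_Un_disjoint) auto
  moreover have "card A = card (A - B) + card (A \<inter> B)"
    using assms by (metis add.commute card_Int_Diff)
  moreover have "card B = card (B - A) + card (A \<inter> B)"
    using assms by (metis add.commute card_Int_Diff inf_commute)
  ultimately show ?thesis by simp
qed

lemma card_diff_set:
  "card (diff_set x z) + 2 * card (diff_set x y \<inter> diff_set y z)
     = card (diff_set x y) + card (diff_set y z)"
  by (metis card_sym_diff diff_set_sym_diff finite)

lemma even_card_diff_set:
  assumes "x \<in> halved_cube_vertices \<epsilon>"
  shows "y \<in> halved_cube_vertices \<epsilon> \<longleftrightarrow> even (card (diff_set x y))"
proof -
  have "even (card (diff_set x 0) + 2 * card (diff_set x y \<inter> diff_set y 0)) =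
        even (card (diff_set x y) + card (diff_set y 0))"
    by (simp only: card_diff_set)
  then show ?thesis
    using assms by (auto simp: halved_cube_vertices_def wt_diff_set)
qed

lemma halved_cube_adj_iff:
  assumes "x \<in> halved_cube_vertices \<epsilon>"
  shows "halved_cube_adj \<epsilon> x y \<longleftrightarrow> card (diff_set x y) = 2"
  using assms even_card_diff_set[OF assms, of y]
  by (auto simp: halved_cube_adj_def wt_diff)

lemma walk_bound:
  "(halved_cube_adj \<epsilon> ^^ k) x y \<Longrightarrow> card (diff_set x y) \<le> 2 * k"
proof (induction k arbitrary: y)
  case 0
  then show ?case by (simp add: diff_set_empty[THEN iffD2])
next
  case (Suc k)
  then obtain z where z: "(halved_cube_adj \<epsilon> ^^ k) x z" "halved_cube_adj \<epsilon> z y"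
    by auto
  have "card (diff_set z y) = 2"
    using z(2) by (simp add: halved_cube_adj_def wt_diff)
  then show ?case
    using Suc.IH[OF z(1)] card_diff_set[of x y z] by simp
qed

lemma walk_exists:
  assumes "x \<in> halved_cube_vertices \<epsilon>" "card (diff_set x y) = 2 * k"
  shows "(halved_cube_adj \<epsilon> ^^ k) x y"
  using assms(2)
proof (induction k arbitrary: y)
  case 0
  then show ?case by (simp add: diff_set_empty)
next
  case (Suc k)
  obtain S where S: "S \<subseteq> diff_set x y" "card S = 2"
    using Suc.prems obtain_subset_with_card_n[of 2 "diff_set x y"] by auto
  define z where "z = flip y S"
  have yz: "diff_set y z = S" by (simp add: z_def diff_set_flip)
  have "card (diff_set x z) = 2 * k"
    using card_diff_set[of x z y] S Suc.prems by (simp add: yz Int_absorb1)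
  then have w: "(halved_cube_adj \<epsilon> ^^ k) x z" and zV: "z \<in> halved_cube_vertices \<epsilon>"
    using Suc.IH even_card_diff_set[OF assms(1), of z] by auto
  have "halved_cube_adj \<epsilon> z y"
    using halved_cube_adj_iff[OF zV] S(2) yz diff_set_commute[of y z] by simp
  with w show ?case by auto
qed

lemma gdist_halved_cube:
  assumes "x \<in> halved_cube_vertices \<epsilon>" "y \<in> halved_cube_vertices \<epsilon>"
  shows "2 * gdist (halved_cube_adj \<epsilon>) x y = card (diff_set x y)"
proof -
  obtain k where k: "card (diff_set x y) = 2 * k"
    using even_card_diff_set assms by blast
  have "gdist (halved_cube_adj \<epsilon>) x y = k"
    unfolding gdist_def
  proof (rule Least_equality)
    show "(halved_cube_adj \<epsilon> ^^ k) x y" by (rule walk_exists[OF assms(1) k])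
    show "k \<le> j" if "(halved_cube_adj \<epsilon> ^^ j) x y" for j
      using walk_bound[OF that] k by simp
  qed
  with k show ?thesis by simp
qed

lemma finite_halved_cube: "finite (halved_cube_vertices \<epsilon> :: (bit ^ 'n) set)"
proof (rule finite_subset)
  show "halved_cube_vertices \<epsilon> \<subseteq> range (flip (0 :: bit ^ 'n))"
    using flip_diff_set by (metis rangeI subsetI)
qed simp

lemma halved_cube_nonempty: "(halved_cube_vertices \<epsilon> :: (bit ^ 'n) set) \<noteq> {}"
proof -
  obtain i :: 'n where True by simp
  have "wt (0 :: bit ^ 'n) = 0" by (simp add: wt_def)
  moreover have "wt (flip 0 {i} :: bit ^ 'n) = 1"
    using diff_set_flip[of 0 "{i}"] by (simp add: wt_diff_set diff_set_commute)
  ultimately have "0 \<in> (halved_cube_vertices \<epsilon> :: (bit ^ 'n) set) \<or>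
      flip 0 {i} \<in> (halved_cube_vertices \<epsilon> :: (bit ^ 'n) set)"
    by (auto simp: halved_cube_vertices_def)
  then show ?thesis by blast
qed

lemma halved_cube_connected:
  "connected_graph (halved_cube_vertices \<epsilon> :: (bit ^ 'n) set) (halved_cube_adj \<epsilon>)"
proof -
  have "halved_cube_adj \<epsilon> y x \<and> x \<noteq> y" if "halved_cube_adj \<epsilon> x y" for x y :: "bit ^ 'n"
    using that diff_set_empty[of x y]
    by (auto simp: halved_cube_adj_def wt_diff diff_set_commute)
  then have "simple_graph (halved_cube_vertices \<epsilon> :: (bit ^ 'n) set) (halved_cube_adj \<epsilon>)"
    by (auto simp: simple_graph_def halved_cube_adj_def finite_halved_cube)
  moreover have "\<exists>k. (halved_cube_adj \<epsilon> ^^ k) x y"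
    if "x \<in> halved_cube_vertices \<epsilon>" "y \<in> halved_cube_vertices \<epsilon>" for x y :: "bit ^ 'n"
    using walk_exists[OF that(1), of y] even_card_diff_set[OF that(1), of y] that(2) by blast
  ultimately show ?thesis
    by (auto simp: connected_graph_def halved_cube_nonempty)
qed

lemma halved_cube_diam:
  "diam (halved_cube_vertices \<epsilon> :: (bit ^ 'n) set) (halved_cube_adj \<epsilon>) = CARD('n) div 2"
  unfolding diam_def
proof (rule Max_eqI)
  let ?V = "halved_cube_vertices \<epsilon> :: (bit ^ 'n) set"
  let ?D = "{gdist (halved_cube_adj \<epsilon>) x y | x y. x \<in> ?V \<and> y \<in> ?V}"
  have "?D = (\<lambda>(x, y). gdist (halved_cube_adj \<epsilon>) x y) ` (?V \<times> ?V)" by auto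
  then show "finite ?D" by (simp add: finite_halved_cube)
  show "k \<le> CARD('n) div 2" if k: "k \<in> ?D" for k
  proof -
    obtain x y where xy: "x \<in> ?V" "y \<in> ?V" "k = gdist (halved_cube_adj \<epsilon>) x y"
      using k by auto
    have "2 * k = card (diff_set x y)" using gdist_halved_cube xy by auto
    also have "\<dots> \<le> CARD('n)" by (simp add: card_mono)
    finally show ?thesis by simp
  qed
  obtain x where x: "x \<in> ?V" using halved_cube_nonempty by auto
  obtain S :: "'n set" where S: "card S = 2 * (CARD('n) div 2)"
    using obtain_subset_with_card_n[of "2 * (CARD('n) div 2)" "UNIV :: 'n set"] by auto
  have "flip x S \<in> ?V" using even_card_diff_set[OF x] S by (simp add: diff_set_flip)
  moreover from this have "2 * gdist (halved_cube_adj \<epsilon>) x (flip x S) = 2 * (CARD('n) div 2)"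
    using gdist_halved_cube[OF x] S by (simp add: diff_set_flip)
  ultimately show "CARD('n) div 2 \<in> ?D" using x by force
qed

lemma halved_cube_neighbours:
  assumes x: "x \<in> halved_cube_vertices \<epsilon>" and y: "y \<in> halved_cube_vertices \<epsilon>"
  shows "card {z \<in> halved_cube_vertices \<epsilon>. halved_cube_adj \<epsilon> y z \<and>
             P (gdist (halved_cube_adj \<epsilon>) x z)} =
         card {S. card S = 2 \<and>
             P (gdist (halved_cube_adj \<epsilon>) x y + 1 - card (diff_set x y \<inter> S))}"
    (is "card ?N = card ?S")
proof -
  have dist: "gdist (halved_cube_adj \<epsilon>) x z
        = gdist (halved_cube_adj \<epsilon>) x y + 1 - card (diff_set x y \<inter> diff_set y z)"
    if "z \<in> halved_cube_vertices \<epsilon>" "card (diff_set y z) = 2" for z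
    using card_diff_set[of x z y] gdist_halved_cube[OF x that(1)] gdist_halved_cube[OF x y]
      that(2) by linarith
  have V: "flip y S \<in> halved_cube_vertices \<epsilon>" if "card S = 2" for S
    using even_card_diff_set[OF y] that by (simp add: diff_set_flip)
  have "bij_betw (diff_set y) ?N ?S"
  proof (rule bij_betw_byWitness[where f' = "flip y"])
    show "\<forall>z\<in>?N. flip y (diff_set y z) = z" by (simp add: flip_diff_set)
    show "\<forall>S\<in>?S. diff_set y (flip y S) = S" by (simp add: diff_set_flip)
    show "diff_set y ` ?N \<subseteq> ?S"
      using dist by (auto simp: halved_cube_adj_iff[OF y])
    show "flip y ` ?S \<subseteq> ?N"
      using dist[OF V] V by (auto simp: halved_cube_adj_iff[OF y] diff_set_flip)
  qed
  then show ?thesis by (rule bij_betw_same_card)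
qed

lemma halved_cube_intersection_numbers:
  "intersection_numbers (halved_cube_vertices \<epsilon> :: (bit ^ 'n) set) (halved_cube_adj \<epsilon>)
     (\<lambda>i. (CARD('n) - 2 * i) choose 2) (\<lambda>i. (2 * i) choose 2)"
  unfolding intersection_numbers_def
proof (intro ballI allI impI conjI)
  fix x y :: "bit ^ 'n" and i
  assume xy: "x \<in> halved_cube_vertices \<epsilon>" "y \<in> halved_cube_vertices \<epsilon>"
    and i: "gdist (halved_cube_adj \<epsilon>) x y = i"
  let ?T = "diff_set x y"
  have T: "card ?T = 2 * i" using gdist_halved_cube[OF xy] i by simp
  have "{S. card S = 2 \<and> i + 1 - card (?T \<inter> S) = i + 1} = {S. S \<subseteq> - ?T \<and> card S = 2}"
  proof -
    have "i + 1 - card (?T \<inter> S) = i + 1 \<longleftrightarrow> ?T \<inter> S = {}" for S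
      by (cases "card (?T \<inter> S)") (auto simp del: card_0_eq simp: card_eq_0_iff)
    then show ?thesis by auto
  qed
  moreover have "card (- ?T) = CARD('n) - 2 * i"
    using T by (simp add: Compl_eq_Diff_UNIV card_Diff_subset)
  ultimately show "card {z \<in> halved_cube_vertices \<epsilon>. halved_cube_adj \<epsilon> y z \<and>
      gdist (halved_cube_adj \<epsilon>) x z = i + 1} = (CARD('n) - 2 * i) choose 2"
    using halved_cube_neighbours[OF xy, of "\<lambda>k. k = i + 1"] i
    by (simp add: n_subsets)
  have "{S. card S = 2 \<and> i + 1 - card (?T \<inter> S) + 1 = i} = {S. S \<subseteq> ?T \<and> card S = 2}"
  proof (intro Collect_cong iffI)
    fix S
    assume S: "card S = 2 \<and> i + 1 - card (?T \<inter> S) + 1 = i"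
    then have "card S \<le> card (?T \<inter> S)" by linarith
    then have "?T \<inter> S = S" by (intro card_seteq) auto
    then show "S \<subseteq> ?T \<and> card S = 2" using S by auto
  next
    fix S
    assume S: "S \<subseteq> ?T \<and> card S = 2"
    then have "2 \<le> 2 * i" using T card_mono[of ?T S] by simp
    then show "card S = 2 \<and> i + 1 - card (?T \<inter> S) + 1 = i"
      using S by (auto simp: Int_absorb1)
  qed
  then show "card {z \<in> halved_cube_vertices \<epsilon>. halved_cube_adj \<epsilon> y z \<and>
      gdist (halved_cube_adj \<epsilon>) x z + 1 = i} = (2 * i) choose 2"
    using halved_cube_neighbours[OF xy, of "\<lambda>k. k + 1 = i"] i T
    by (simp add: n_subsets)
qed

lemma real_choose_two: "real (k choose 2) = real k * (real k - 1) / 2"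
proof (cases k)
  case (Suc m)
  have "even (k * (k - 1))" using Suc by simp
  then have "real (k choose 2) = real (k * (k - 1)) / 2"
    by (simp only: choose_two real_of_nat_div)
  then show ?thesis using Suc by (simp add: algebra_simps)
qed simp

theorem halved_cube_classical_parameters:
  assumes "CARD('n) = 2 * d \<or> CARD('n) = 2 * d + 1"
  shows "classical_parameters (halved_cube_vertices \<epsilon> :: (bit ^ 'n) set) (halved_cube_adj \<epsilon>)
           d 1 2 (if CARD('n) = 2 * d then 2 * real d - 1 else 2 * real d + 1)"
proof -
  have "real ((CARD('n) - 2 * i) choose 2) = (real d - real i) *
      ((if CARD('n) = 2 * d then 2 * real d - 1 else 2 * real d + 1) - 2 * real i)"
    if "i \<le> d" for i
    using assms that by (auto simp: real_choose_two of_nat_diff field_simps)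
  moreover have "real ((2 * i) choose 2) = real i * (1 + 2 * real (i - 1))" for i
    by (cases i) (auto simp: real_choose_two field_simps)
  moreover have "q_int 1 i = real i" for i by (simp add: q_int_def)
  moreover have "CARD('n) div 2 = d" using assms by auto
  ultimately show ?thesis
    unfolding classical_parameters_def halved_cube_diam
    by (intro conjI exI[of _ "\<lambda>i. (CARD('n) - 2 * i) choose 2"]
          exI[of _ "\<lambda>i. (2 * i) choose 2"] allI impI
          halved_cube_connected halved_cube_intersection_numbers)
      (simp_all only:)
qed

end

(* If Y has dual width s, its characteristic function is a sum of polynomials of degree at most s
   in the distances to the points of Y, since the Q-polynomial recurrence makes E_j a polynomial of
   degree j in the distance and E_j annihilates Y for j > s.  Hence, as a function of a subset S of
   the coordinates (those flipped from a base point in Y), it is a polynomial of degree at most s.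

   Averaging over all S that meet a fixed T and its complement in p and q elements gives a
   polynomial in (p, q) of total degree at most s = d - w.  As Y has width w, its zeros determine
   it where needed: the number of neighbours of x in Y is binomial(n, 2) * w / d, and if x, y in Y
   are at distance w then Y contains every vertex on a geodesic from x to y.

   For w = 1 the neighbours of x form an intersecting family of pairs, hence a star.  For w > 1,
   let T (of size 2w) be the set of coordinates in which x, y differ.  Convexity allows at most one
   coordinate outside T to occur in an edge at x, so the valency is at most binomial(2w + 1, 2),
   which forces n = 2d and w = d - 1. *)

theory Submission
  imports Defs "HOL-Computational_Algebra.Polynomial"
begin

section \<open>Idempotents of the Bose--Mesner algebra\<close>

locale finite_connected_graph =
  fixes V :: "'a set" and adj :: "'a \<Rightarrow> 'a \<Rightarrow> bool"
  assumes connected: "connected_graph V adj"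
begin

lemma finite_V: "finite V" and V_nonempty: "V \<noteq> {}"
  using connected by (auto simp: connected_graph_def simple_graph_def)

lemma gdist_sym: "gdist adj x y = gdist adj y x"
proof -
  have adj: "adj u v \<Longrightarrow> adj v u" for u v
    using connected by (auto simp: connected_graph_def simple_graph_def)
  have "(adj ^^ k) u v \<Longrightarrow> (adj ^^ k) v u" for k u v
  proof (induction k arbitrary: v)
    case (Suc k)
    then obtain w where "(adj ^^ k) w u" "adj v w" using adj by auto
    then show ?case by (rule relpowp_Suc_I2[rotated])
  qed simp
  then have "(adj ^^ k) x y \<longleftrightarrow> (adj ^^ k) y x" for k by blast
  then show ?thesis by (simp add: gdist_def)
qed

lemma gdist_eq_0_iff:
  assumes "x \<in> V" "y \<in> V"
  shows "gdist adj x y = 0 \<longleftrightarrow> x = y"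
proof
  have "\<exists>k. (adj ^^ k) x y" using assms connected by (auto simp: connected_graph_def)
  then have "(adj ^^ gdist adj x y) x y" unfolding gdist_def by (rule LeastI_ex)
  then show "gdist adj x y = 0 \<Longrightarrow> x = y" by simp
qed (auto simp: gdist_def)

lemma gdist_le_diam:
  assumes "x \<in> V" "y \<in> V"
  shows "gdist adj x y \<le> diam V adj"
proof -
  have "{gdist adj x y | x y. x \<in> V \<and> y \<in> V} = (\<lambda>(x, y). gdist adj x y) ` (V \<times> V)"
    by auto
  then show ?thesis
    unfolding diam_def using assms finite_V by (intro Max_ge) auto
qed

lemma quad_form_dist_matrix:
  assumes "Y \<subseteq> V"
  shows "quad_form V (dist_matrix V adj i) Y =
    of_nat (card {(x, y). x \<in> Y \<and> y \<in> Y \<and> gdist adj x y = i})"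
proof -
  have sub: "{(x, y). x \<in> Y \<and> y \<in> Y \<and> gdist adj x y = i} \<subseteq> V \<times> V" using assms by auto
  have "quad_form V (dist_matrix V adj i) Y =
      (\<Sum>(x, y)\<in>V \<times> V. of_bool ((x, y) \<in> {(x, y). x \<in> Y \<and> y \<in> Y \<and> gdist adj x y = i}))"
    unfolding quad_form_def dist_matrix_def sum.cartesian_product
    by (intro sum.cong) (auto simp: indicator_def)
  also have "\<dots> = (\<Sum>p\<in>V \<times> V. of_bool (p \<in> {(x, y). x \<in> Y \<and> y \<in> Y \<and> gdist adj x y = i}))"
    by (intro sum.cong) auto
  also have "\<dots> = of_nat (card {(x, y). x \<in> Y \<and> y \<in> Y \<and> gdist adj x y = i})"
    using finite_V sub by (subst sum_of_bool_eq) (auto simp: Int_absorb1)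
  finally show ?thesis .
qed

lemma quad_form_dist_matrix_eq_0_iff:
  assumes "Y \<subseteq> V"
  shows "quad_form V (dist_matrix V adj i) Y = 0 \<longleftrightarrow> (\<forall>x\<in>Y. \<forall>y\<in>Y. gdist adj x y \<noteq> i)"
proof -
  have "finite {(x, y). x \<in> Y \<and> y \<in> Y \<and> gdist adj x y = i}"
    by (rule finite_subset[of _ "V \<times> V"]) (use assms finite_V in auto)
  then show ?thesis by (auto simp: quad_form_dist_matrix[OF assms])
qed

lemma gdist_le_width:
  assumes "Y \<subseteq> V" "x \<in> Y" "y \<in> Y"
  shows "gdist adj x y \<le> width V adj Y"
  unfolding width_def
  using assms gdist_le_diam[of x y] quad_form_dist_matrix_eq_0_iff[OF assms(1), of "gdist adj x y"]
  by (intro Max_ge) auto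

lemma width_attained:
  assumes "Y \<subseteq> V" "Y \<noteq> {}"
  obtains x y where "x \<in> Y" "y \<in> Y" "gdist adj x y = width V adj Y"
proof -
  obtain x where x: "x \<in> Y" using assms(2) by blast
  then have "quad_form V (dist_matrix V adj 0) Y \<noteq> 0"
    using assms gdist_eq_0_iff[of x x] by (auto simp: quad_form_dist_matrix_eq_0_iff)
  then have "width V adj Y \<in> {i. i \<le> diam V adj \<and> quad_form V (dist_matrix V adj i) Y \<noteq> 0}"
    unfolding width_def by (intro Max_in) auto
  then show thesis
    using that assms(1) by (auto simp: quad_form_dist_matrix_eq_0_iff)
qed

lemma quad_form_above_dual_width:
  assumes "dual_width V adj E Y < i" "i \<le> diam V adj"
  shows "quad_form V (E i) Y = 0"
proof (rule ccontr)
  assume "quad_form V (E i) Y \<noteq> 0"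
  then have "i \<le> dual_width V adj E Y"
    unfolding dual_width_def using assms(2) by (intro Max_ge) auto
  then show False using assms(1) by simp
qed

lemma sum_dist_matrix:
  "(\<Sum>i\<le>diam V adj. k i * dist_matrix V adj i x y) =
    (if x \<in> V \<and> y \<in> V then k (gdist adj x y) else 0)"
proof (cases "x \<in> V \<and> y \<in> V")
  case True
  then have "(\<Sum>i\<le>diam V adj. k i * dist_matrix V adj i x y) =
      (\<Sum>i\<le>diam V adj. if gdist adj x y = i then k i else 0)"
    by (intro sum.cong) (auto simp: dist_matrix_def)
  then show ?thesis using True gdist_le_diam[of x y] by simp
next
  case False
  then have "\<And>i. dist_matrix V adj i x y = 0"
    by (simp only: dist_matrix_def) auto
  then show ?thesis using False by auto
qed

text \<open>The distance matrices have disjoint supports covering \<open>V \<times> V\<close>, so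
  the coefficients can be read off entrywise.\<close>

lemma bose_mesner_iff:
  "M \<in> bose_mesner V adj \<longleftrightarrow>
    (\<exists>k. M = (\<lambda>x y. if x \<in> V \<and> y \<in> V then k (gdist adj x y) else 0))"
  by (simp add: bose_mesner_def sum_dist_matrix)

end

text \<open>Closure under products is the defining property of an association scheme. It is an
  assumption here; for the halved cube it is checked through the coordinate permutations.\<close>

locale bose_mesner_algebra = finite_connected_graph +
  assumes mult_closed: "M \<in> bose_mesner V adj \<Longrightarrow> N \<in> bose_mesner V adj \<Longrightarrow>
      mat_mult V M N \<in> bose_mesner V adj"
begin

section \<open>Commutativity, conjugation and primitive idempotents\<close>

lemma bose_mesner_outside:
  assumes "M \<in> bose_mesner V adj" "\<not> (x \<in> V \<and> y \<in> V)"
  shows "M x y = 0"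
  using assms unfolding bose_mesner_iff by auto

lemma bose_mesner_sym:
  assumes "M \<in> bose_mesner V adj"
  shows "M x y = M y x"
  using assms gdist_sym unfolding bose_mesner_iff by auto

text \<open>Transposition reverses a product, and the factors as well as the product are
  symmetric.\<close>

lemma mult_commute:
  assumes M: "M \<in> bose_mesner V adj" and N: "N \<in> bose_mesner V adj"
  shows "mat_mult V M N = mat_mult V N M"
proof (intro ext)
  fix x y
  have "mat_mult V M N x y = mat_mult V M N y x"
    by (rule bose_mesner_sym[OF mult_closed[OF M N]])
  also have "\<dots> = mat_mult V N M x y"
    using bose_mesner_sym[OF M] bose_mesner_sym[OF N]
    by (simp add: mat_mult_def mult.commute)
  finally show "mat_mult V M N x y = mat_mult V N M x y" .
qed

lemma mult_assoc: "mat_mult V (mat_mult V A B) C = mat_mult V A (mat_mult V B C)"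
  unfolding mat_mult_def sum_distrib_left sum_distrib_right
  by (subst sum.swap) (simp add: mult.assoc)

lemma diff_closed:
  assumes "M \<in> bose_mesner V adj" "N \<in> bose_mesner V adj"
  shows "(\<lambda>x y. M x y - N x y) \<in> bose_mesner V adj"
proof -
  from assms obtain k l where
    "M = (\<lambda>x y. if x \<in> V \<and> y \<in> V then k (gdist adj x y) else 0)"
    "N = (\<lambda>x y. if x \<in> V \<and> y \<in> V then l (gdist adj x y) else 0)"
    by (auto simp: bose_mesner_iff)
  then show ?thesis
    unfolding bose_mesner_iff by (intro exI[of _ "\<lambda>i. k i - l i"]) (auto intro!: ext)
qed

lemma mult_diff_left:
  "mat_mult V (\<lambda>x y. A x y - B x y) C = (\<lambda>x y. mat_mult V A C x y - mat_mult V B C x y)"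
  by (simp add: mat_mult_def left_diff_distrib sum_subtractf)

lemma mult_diff_right:
  "mat_mult V C (\<lambda>x y. A x y - B x y) = (\<lambda>x y. mat_mult V C A x y - mat_mult V C B x y)"
  by (simp add: mat_mult_def right_diff_distrib sum_subtractf)

lemma cnj_idempotent:
  assumes "M \<in> idempotents V adj"
  shows "(\<lambda>x y. cnj (M x y)) \<in> idempotents V adj"
proof -
  from assms obtain k where k: "M = (\<lambda>x y. if x \<in> V \<and> y \<in> V then k (gdist adj x y) else 0)"
    and M: "mat_mult V M M = M"
    by (auto simp: bose_mesner_iff idempotents_def)
  have "(\<lambda>x y. cnj (M x y)) \<in> bose_mesner V adj"
    unfolding bose_mesner_iff by (rule exI[of _ "\<lambda>i. cnj (k i)"]) (auto simp: k intro!: ext)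
  moreover have "mat_mult V (\<lambda>x y. cnj (M x y)) (\<lambda>x y. cnj (M x y)) = (\<lambda>x y. cnj (M x y))"
  proof (intro ext)
    fix x y
    have "cnj (mat_mult V M M x y) = cnj (M x y)" by (simp only: M)
    then show "mat_mult V (\<lambda>x y. cnj (M x y)) (\<lambda>x y. cnj (M x y)) x y = cnj (M x y)"
      by (simp add: mat_mult_def)
  qed
  ultimately show ?thesis by (simp add: idempotents_def)
qed

text \<open>\<open>M\<close> is the sum of the mutually orthogonal idempotents \<open>?F\<close> and
  \<open>?G\<close>, so primitivity makes one of them vanish.\<close>

lemma primitive_absorb:
  assumes M: "M \<in> primitive_idempotents V adj" and N: "N \<in> idempotents V adj"
  shows "mat_mult V M N = (\<lambda>x y. 0) \<or> mat_mult V M N = M"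
proof (rule ccontr)
  let ?F = "mat_mult V M N" and ?G = "\<lambda>x y. M x y - mat_mult V M N x y"
  assume neg: "\<not> ?thesis"
  have MB: "M \<in> bose_mesner V adj" and MM: "mat_mult V M M = M"
    using M by (auto simp: primitive_idempotents_def idempotents_def)
  have NB: "N \<in> bose_mesner V adj" and NN: "mat_mult V N N = N"
    using N by (auto simp: idempotents_def)
  have FF: "mat_mult V ?F ?F = ?F"
    by (metis MB MM NB NN mult_assoc mult_commute)
  have MF: "mat_mult V M ?F = ?F" by (metis MM mult_assoc)
  have FM: "mat_mult V ?F M = ?F" by (metis MB MM NB mult_assoc mult_commute)
  have F: "?F \<in> idempotents V adj"
    using FF mult_closed[OF MB NB] by (simp add: idempotents_def)
  have G: "?G \<in> idempotents V adj"
    using diff_closed[OF MB mult_closed[OF MB NB]]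
    by (simp add: idempotents_def mult_diff_left mult_diff_right FF MF FM MM)
  have "mat_mult V ?F ?G = (\<lambda>x y. 0)" "mat_mult V ?G ?F = (\<lambda>x y. 0)"
    by (simp_all add: mult_diff_left mult_diff_right FF MF FM)
  moreover have "?G \<noteq> (\<lambda>x y. 0)"
  proof
    assume "?G = (\<lambda>x y. 0)"
    then have "?F x y = M x y" for x y by (metis eq_iff_diff_eq_0)
    then show False using neg by blast
  qed
  moreover have "M = (\<lambda>x y. ?F x y + ?G x y)" by simp
  ultimately show False
    using M F G neg unfolding primitive_idempotents_def by blast
qed

text \<open>By symmetry the diagonal entries of the product of \<open>M\<close> with its conjugate
  are sums of squared moduli over a row, so the product is nonzero and must be \<open>M\<close>
  itself. Conjugation swaps the two factors, which commute, hence \<open>M\<close> equals its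
  conjugate.\<close>

lemma primitive_real:
  assumes M: "M \<in> primitive_idempotents V adj"
  shows "cnj (M x y) = M x y"
proof -
  let ?C = "\<lambda>x y. cnj (M x y)"
  have MI: "M \<in> idempotents V adj" and M0: "M \<noteq> (\<lambda>x y. 0)"
    using M by (auto simp: primitive_idempotents_def)
  note C = cnj_idempotent[OF MI]
  have MB: "M \<in> bose_mesner V adj" and CB: "?C \<in> bose_mesner V adj"
    using MI C by (auto simp: idempotents_def)
  have "mat_mult V M ?C \<noteq> (\<lambda>x y. 0)"
  proof
    assume 0: "mat_mult V M ?C = (\<lambda>x y. 0)"
    have "M u v = 0" for u v
    proof (cases "u \<in> V \<and> v \<in> V")
      case True
      have "(\<Sum>z\<in>V. M u z * cnj (M z u)) = 0"
        using fun_cong[OF fun_cong[OF 0, of u], of u] by (simp add: mat_mult_def)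
      then have "(\<Sum>z\<in>V. M u z * cnj (M u z)) = 0"
        using bose_mesner_sym[OF MB] by simp
      then have "complex_of_real (\<Sum>z\<in>V. (cmod (M u z))\<^sup>2) = 0"
        by (simp only: complex_norm_square of_real_sum)
      then have "(\<Sum>z\<in>V. (cmod (M u z))\<^sup>2) = 0"
        by (simp only: of_real_eq_0_iff)
      then show ?thesis
        using True finite_V by (simp add: sum_nonneg_eq_0_iff)
    next
      case False
      then show ?thesis by (rule bose_mesner_outside[OF MB])
    qed
    then show False using M0 by blast
  qed
  then have *: "mat_mult V M ?C = M" using primitive_absorb[OF M C] by blast
  have "cnj (mat_mult V M ?C x y) = mat_mult V ?C M x y" by (simp add: mat_mult_def)
  then show ?thesis
    using * mult_commute[OF MB CB] by metis
qed

text \<open>\<open>M\<close> is a real symmetric idempotent, so the quadratic form is the squared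
  norm of \<open>M\<close> applied to the characteristic vector of \<open>Y\<close>.\<close>

lemma primitive_kernel:
  assumes M: "M \<in> primitive_idempotents V adj" and q: "quad_form V M Y = 0"
    and Y: "Y \<subseteq> V"
  shows "(\<Sum>y\<in>Y. M x y) = 0"
proof (cases "x \<in> V")
  case True
  let ?f = "\<lambda>x. \<Sum>y\<in>Y. M x y"
  have MB: "M \<in> bose_mesner V adj" and MM: "mat_mult V M M = M"
    using M by (auto simp: primitive_idempotents_def idempotents_def)
  have ind: "(\<Sum>y\<in>V. g y * indicator Y y) = (\<Sum>y\<in>Y. g y)" for g :: "'a \<Rightarrow> complex"
    using Y finite_V by (simp add: Indicator_Function.sum_mult_indicator Int_absorb1)
  have ind': "(\<Sum>y\<in>V. indicator Y y * g y) = (\<Sum>y\<in>Y. g y)" for g :: "'a \<Rightarrow> complex"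
    using ind[of g] by (simp add: mult.commute)
  have "quad_form V M Y = (\<Sum>x\<in>Y. \<Sum>y\<in>Y. M x y)"
    by (simp add: quad_form_def mult.assoc sum_distrib_left[symmetric] ind ind')
  also have "\<dots> = (\<Sum>x\<in>Y. \<Sum>y\<in>Y. \<Sum>z\<in>V. M x z * M z y)"
    by (subst MM[symmetric]) (simp add: mat_mult_def)
  also have "\<dots> = (\<Sum>z\<in>V. (\<Sum>x\<in>Y. M x z) * ?f z)"
    unfolding sum_product by (subst sum.swap[of _ V]) (simp add: sum.swap[of _ V])
  also have "\<dots> = (\<Sum>z\<in>V. cnj (?f z) * ?f z)"
    using bose_mesner_sym[OF MB] primitive_real[OF M] by simp
  also have "\<dots> = complex_of_real (\<Sum>z\<in>V. (cmod (?f z))\<^sup>2)"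
    by (simp only: complex_norm_square of_real_sum mult.commute)
  finally have "(\<Sum>z\<in>V. (cmod (?f z))\<^sup>2) = 0"
    using q by (metis of_real_eq_0_iff)
  then show ?thesis
    using True finite_V by (simp add: sum_nonneg_eq_0_iff)
next
  case False
  have "M \<in> bose_mesner V adj"
    using M by (auto simp: primitive_idempotents_def idempotents_def)
  then have "M x y = 0" for y using bose_mesner_outside False by blast
  then show ?thesis by simp
qed

section \<open>The Q-polynomial recurrence and polynomials in the distance\<close>

lemma Q_polynomial_recurrence:
  assumes Q: "Q_polynomial V adj E" and \<theta>: "dual_eigenvalues V adj E \<theta>"
    and lin: "\<And>i. i \<le> diam V adj \<Longrightarrow> \<theta> i = \<xi> * of_nat (diam V adj - i) + \<zeta>"
  obtains as bs cs where
    "\<And>i. i < diam V adj \<Longrightarrow> cs (Suc i) \<noteq> 0"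
    "\<And>i x y. i \<le> diam V adj \<Longrightarrow> x \<in> V \<Longrightarrow> y \<in> V \<Longrightarrow>
      \<xi> * (of_nat (gdist adj x y) * E i x y) =
        as i * E i x y - (if i = 0 then 0 else bs i * E (i - 1) x y)
          - (if i = diam V adj then 0 else cs (Suc i) * E (Suc i) x y)"
proof -
  let ?D = "diam V adj"
  obtain a b c where ne: "\<forall>i\<in>{1..?D}. b (i - 1) * c i \<noteq> (0 :: complex)"
    and eq: "\<And>i x y. i \<le> ?D \<Longrightarrow> x \<in> V \<Longrightarrow> y \<in> V \<Longrightarrow>
      E 1 x y * E i x y = 1 / of_nat (card V) *
             ((if i = 0 then 0 else b (i - 1) * E (i - 1) x y)
              + a i * E i x y
              + (if i = ?D then 0 else c (i + 1) * E (i + 1) x y))"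
    using Q unfolding Q_polynomial_def by metis
  have card: "(of_nat (card V) :: complex) \<noteq> 0" using finite_V V_nonempty by simp
  show thesis
  \<comment> \<open>The dual eigenvalues are affine in the distance, so multiplication by
    \<open>E 1\<close> becomes multiplication by the distance. Solving for the latter changes
    \<open>a i\<close> into \<open>\<xi> * of_nat ?D + \<zeta> - a i\<close> and shifts the index of
    \<open>b\<close>.\<close>
  proof (rule that[of c "\<lambda>i. \<xi> * of_nat ?D + \<zeta> - a i" "\<lambda>i. b (i - 1)"])
    show "c (Suc i) \<noteq> 0" if "i < ?D" for i
      using ne that by force
    fix i x y assume i: "i \<le> ?D" and xy: "x \<in> V" "y \<in> V"
    let ?g = "gdist adj x y"
    have "of_nat (card V) * E 1 x y = \<theta> ?g"
      using \<theta> xy by (simp add: dual_eigenvalues_def sum_dist_matrix)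
    also have "\<dots> = \<xi> * (of_nat ?D - of_nat ?g) + \<zeta>"
      using lin[OF gdist_le_diam[OF xy]] gdist_le_diam[OF xy] by (simp add: of_nat_diff)
    finally have "(\<xi> * (of_nat ?D - of_nat ?g) + \<zeta>) * E i x y =
        of_nat (card V) * (E 1 x y * E i x y)" by (simp only: mult.assoc flip: mult.assoc)
    also have "\<dots> = (if i = 0 then 0 else b (i - 1) * E (i - 1) x y) + a i * E i x y
              + (if i = ?D then 0 else c (i + 1) * E (i + 1) x y)"
      unfolding eq[OF i xy] using card by simp
    finally show "\<xi> * (of_nat ?g * E i x y) =
        (\<xi> * of_nat ?D + \<zeta> - a i) * E i x y - (if i = 0 then 0 else b (i - 1) * E (i - 1) x y)
          - (if i = ?D then 0 else c (Suc i) * E (Suc i) x y)"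
      by (simp add: algebra_simps)
  qed
qed

text \<open>The recurrence can be solved for \<open>E (Suc i)\<close> because
  \<open>cs (Suc i)\<close> is nonzero; the factor given by the distance raises the degree by one at
  each step.\<close>

lemma idempotent_poly_gdist:
  assumes Q: "Q_polynomial V adj E" and \<theta>: "dual_eigenvalues V adj E \<theta>"
    and lin: "\<And>i. i \<le> diam V adj \<Longrightarrow> \<theta> i = \<xi> * of_nat (diam V adj - i) + \<zeta>"
    and "j \<le> diam V adj"
  shows "\<exists>P. degree P \<le> j \<and> (\<forall>x\<in>V. \<forall>y\<in>V. E j x y = poly P (of_nat (gdist adj x y)))"
  using \<open>j \<le> diam V adj\<close>
proof (induction j rule: less_induct)
  case (less j)
  obtain as bs cs where cs: "\<And>i. i < diam V adj \<Longrightarrow> cs (Suc i) \<noteq> 0"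
    and rec: "\<And>i x y. i \<le> diam V adj \<Longrightarrow> x \<in> V \<Longrightarrow> y \<in> V \<Longrightarrow>
      \<xi> * (of_nat (gdist adj x y) * E i x y) =
        as i * E i x y - (if i = 0 then 0 else bs i * E (i - 1) x y)
          - (if i = diam V adj then 0 else cs (Suc i) * E (Suc i) x y)"
    using Q_polynomial_recurrence[OF Q \<theta> lin] by metis
  show ?case
  proof (cases j)
    case 0
    have "E 0 = (\<lambda>x y. if x \<in> V \<and> y \<in> V then 1 / of_nat (card V) else 0)"
      using Q by (simp add: Q_polynomial_def idempotent_ordering_def)
    then show ?thesis
      using 0 by (intro exI[of _ "[:1 / of_nat (card V):]"]) simp
  next
    case (Suc i)
    obtain P where P: "degree P \<le> i"
      "\<And>x y. x \<in> V \<Longrightarrow> y \<in> V \<Longrightarrow> E i x y = poly P (of_nat (gdist adj x y))"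
      using less.IH[of i] less.prems Suc by auto
    obtain R where R: "degree R \<le> i"
      "\<And>x y. x \<in> V \<Longrightarrow> y \<in> V \<Longrightarrow> (if i = 0 then 0 else bs i * E (i - 1) x y) =
          poly R (of_nat (gdist adj x y))"
    proof (cases i)
      case 0
      then show thesis using that[of 0] by simp
    next
      case (Suc k)
      then obtain R where "degree R \<le> k"
        "\<forall>x\<in>V. \<forall>y\<in>V. E k x y = poly R (of_nat (gdist adj x y))"
        using less.IH[of k] less.prems \<open>j = Suc i\<close> by auto
      then show thesis
        using that[of "smult (bs i) R"] Suc degree_smult_le[of "bs i" R] by auto
    qed
    let ?S = "smult (1 / cs j) (smult (as i) P - R - smult \<xi> ([:0, 1:] * P))"
    have "degree ([:0, 1:] * P) \<le> j"
      using P(1) Suc degree_mult_le[of "[:0, 1:]" P] by simp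
    then have "degree ?S \<le> j"
      using P(1) R(1) Suc by (intro order_trans[OF degree_smult_le] degree_diff_le) auto
    moreover have "E j x y = poly ?S (of_nat (gdist adj x y))" if "x \<in> V" "y \<in> V" for x y
    proof -
      have "cs j * E j x y = as i * E i x y - (if i = 0 then 0 else bs i * E (i - 1) x y)
          - \<xi> * (of_nat (gdist adj x y) * E i x y)"
        using rec[OF _ that, of i] less.prems Suc by simp
      also have "\<dots> = cs j * poly ?S (of_nat (gdist adj x y))"
        unfolding R(2)[OF that] P(2)[OF that] using cs[of i] less.prems Suc by simp
      finally show ?thesis using cs[of i] less.prems Suc mult_left_cancel by (metis Suc_le_eq)
    qed
    ultimately show ?thesis by blast
  qed
qed

text \<open>The span of the \<open>E i\<close> contains the constants, through \<open>E 0\<close>,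
  and is closed under entrywise multiplication by the distance, since the recurrence can be divided
  by \<open>\<xi>\<close>.\<close>

lemma poly_gdist_in_span:
  assumes Q: "Q_polynomial V adj E" and \<theta>: "dual_eigenvalues V adj E \<theta>"
    and lin: "\<And>i. i \<le> diam V adj \<Longrightarrow> \<theta> i = \<xi> * of_nat (diam V adj - i) + \<zeta>"
    and "\<xi> \<noteq> 0"
  shows "\<exists>\<alpha>. \<forall>x\<in>V. \<forall>y\<in>V.
    poly P (of_nat (gdist adj x y)) = (\<Sum>i\<le>diam V adj. \<alpha> i * E i x y)"
proof -
  let ?D = "diam V adj"
  \<comment> \<open>Equality is required on \<open>V\<close> only, since a polynomial in the
    distance need not vanish outside \<open>V\<close>.\<close>
  define spanned :: "'a matrix \<Rightarrow> bool" where
    "spanned F \<longleftrightarrow> (\<exists>\<alpha>. \<forall>x\<in>V. \<forall>y\<in>V. F x y = (\<Sum>i\<le>?D. \<alpha> i * E i x y))" for F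
  have add: "spanned (\<lambda>x y. F x y + G x y)" if F: "spanned F" and G: "spanned G" for F G
  proof -
    from F G obtain \<alpha> \<beta> where
      "\<forall>x\<in>V. \<forall>y\<in>V. F x y = (\<Sum>i\<le>?D. \<alpha> i * E i x y)"
      "\<forall>x\<in>V. \<forall>y\<in>V. G x y = (\<Sum>i\<le>?D. \<beta> i * E i x y)"
      unfolding spanned_def by blast
    then show ?thesis
      unfolding spanned_def
      by (intro exI[of _ "\<lambda>i. \<alpha> i + \<beta> i"]) (simp add: distrib_right sum.distrib)
  qed
  have scale: "spanned (\<lambda>x y. c * F x y)" if F: "spanned F" for c F
  proof -
    from F obtain \<alpha> where "\<forall>x\<in>V. \<forall>y\<in>V. F x y = (\<Sum>i\<le>?D. \<alpha> i * E i x y)"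
      unfolding spanned_def by blast
    then show ?thesis
      unfolding spanned_def
      by (intro exI[of _ "\<lambda>i. c * \<alpha> i"]) (simp add: sum_distrib_left mult.assoc)
  qed
  have cong: "spanned F" if "spanned G" "\<And>x y. x \<in> V \<Longrightarrow> y \<in> V \<Longrightarrow> F x y = G x y" for F G
    using that unfolding spanned_def by simp
  have sum: "spanned (\<lambda>x y. \<Sum>i\<in>I. F i x y)" if "finite I" "\<And>i. i \<in> I \<Longrightarrow> spanned (F i)"
    for I :: "nat set" and F
    using that
  proof (induction I rule: finite_induct)
    case empty
    show ?case unfolding spanned_def by (intro exI[of _ "\<lambda>i. 0"]) simp
  next
    case (insert i I)
    then show ?case using add[of "F i" "\<lambda>x y. \<Sum>i\<in>I. F i x y"] by simp
  qed
  have basis: "spanned (E i)" if "i \<le> ?D" for i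
    unfolding spanned_def
  proof (intro exI ballI)
    fix x y
    have "(\<Sum>k\<le>?D. (if k = i then 1 else 0) * E k x y) = (\<Sum>k\<le>?D. if k = i then E k x y else 0)"
      by (intro sum.cong) auto
    then show "E i x y = (\<Sum>k\<le>?D. (if k = i then 1 else 0) * E k x y)"
      using that by simp
  qed
  have basis_dist: "spanned (\<lambda>x y. of_nat (gdist adj x y) * E i x y)" if i: "i \<le> ?D" for i
  proof -
    obtain as bs cs where rec: "\<And>x y. x \<in> V \<Longrightarrow> y \<in> V \<Longrightarrow>
        \<xi> * (of_nat (gdist adj x y) * E i x y) =
        as i * E i x y - (if i = 0 then 0 else bs i * E (i - 1) x y)
          - (if i = ?D then 0 else cs (Suc i) * E (Suc i) x y)"
      using Q_polynomial_recurrence[OF Q \<theta> lin] i by metis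
    have "spanned (\<lambda>x y. (if i = 0 then 0 else - bs i / \<xi>) * E (i - 1) x y)"
      using i by (intro scale basis) auto
    moreover have "spanned (\<lambda>x y. (if i = ?D then 0 else - cs (Suc i) / \<xi>) * E (Suc i) x y)"
    proof (cases "i = ?D")
      case True
      then show ?thesis using scale[OF basis[of 0], of 0] by simp
    next
      case False
      then have "Suc i \<le> ?D" using i by simp
      then show ?thesis by (intro scale basis)
    qed
    ultimately have "spanned (\<lambda>x y. as i / \<xi> * E i x y +
        ((if i = 0 then 0 else - bs i / \<xi>) * E (i - 1) x y +
         (if i = ?D then 0 else - cs (Suc i) / \<xi>) * E (Suc i) x y))"
      by (rule add[OF scale[OF basis[OF i]] add])
    then show ?thesis
    proof (rule cong)
      fix x y assume "x \<in> V" "y \<in> V"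
      then have "of_nat (gdist adj x y) * E i x y = (as i * E i x y -
          (if i = 0 then 0 else bs i * E (i - 1) x y)
          - (if i = ?D then 0 else cs (Suc i) * E (Suc i) x y)) / \<xi>"
        using rec[of x y] \<open>\<xi> \<noteq> 0\<close> by (simp add: eq_divide_eq mult.commute)
      then show "of_nat (gdist adj x y) * E i x y = as i / \<xi> * E i x y +
        ((if i = 0 then 0 else - bs i / \<xi>) * E (i - 1) x y +
         (if i = ?D then 0 else - cs (Suc i) / \<xi>) * E (Suc i) x y)"
        by (simp add: diff_divide_distrib)
    qed
  qed
  have dist: "spanned (\<lambda>x y. of_nat (gdist adj x y) * F x y)" if F: "spanned F" for F
  proof -
    from F obtain \<alpha> where "\<forall>x\<in>V. \<forall>y\<in>V. F x y = (\<Sum>i\<le>?D. \<alpha> i * E i x y)"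
      unfolding spanned_def by blast
    then have "of_nat (gdist adj x y) * F x y =
        (\<Sum>i\<le>?D. \<alpha> i * (of_nat (gdist adj x y) * E i x y))" if "x \<in> V" "y \<in> V" for x y
      using that by (simp add: sum_distrib_left algebra_simps)
    moreover have "spanned (\<lambda>x y. \<Sum>i\<le>?D. \<alpha> i * (of_nat (gdist adj x y) * E i x y))"
      using basis_dist by (intro sum scale) auto
    ultimately show ?thesis by (rule cong[rotated])
  qed
  have const: "spanned (\<lambda>x y. c)" for c
  proof (rule cong[OF scale[OF basis[of 0], of "c * of_nat (card V)"]])
    have "E 0 = (\<lambda>x y. if x \<in> V \<and> y \<in> V then 1 / of_nat (card V) else 0)"
      using Q by (simp add: Q_polynomial_def idempotent_ordering_def)
    then show "x \<in> V \<Longrightarrow> y \<in> V \<Longrightarrow> c = c * of_nat (card V) * E 0 x y" for x y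
      using finite_V V_nonempty by simp
  qed simp
  have "spanned (\<lambda>x y. poly P (of_nat (gdist adj x y)))"
  proof (induction P)
    case 0
    show ?case using const[of 0] by simp
  next
    case (pCons a P)
    then show ?case using add[OF const[of a] dist] by simp
  qed
  then show ?thesis by (simp add: spanned_def)
qed

text \<open>The identity matrix lies in the span of the \<open>E i\<close>; applied to the characteristic vector
  of \<open>Y\<close>, only the terms with \<open>i \<le> s\<close> survive.\<close>

lemma indicator_eq_sum_poly_gdist:
  assumes Q: "Q_polynomial V adj E" and \<theta>: "dual_eigenvalues V adj E \<theta>"
    and lin: "\<And>i. i \<le> diam V adj \<Longrightarrow> \<theta> i = \<xi> * of_nat (diam V adj - i) + \<zeta>"
    and "\<xi> \<noteq> 0" and Y: "Y \<subseteq> V"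
    and s: "\<And>i. s < i \<Longrightarrow> i \<le> diam V adj \<Longrightarrow> quad_form V (E i) Y = 0"
  shows "\<exists>P. degree P \<le> s \<and>
    (\<forall>x\<in>V. (of_bool (x \<in> Y) :: complex) = (\<Sum>y\<in>Y. poly P (of_nat (gdist adj x y))))"
proof -
  let ?D = "diam V adj"
  \<comment> \<open>This interpolation polynomial is 1 at 0 and 0 at \<open>1, ..., ?D\<close>, so
    its values at the distances form the identity matrix.\<close>
  define \<delta> :: "complex poly" where "\<delta> = (\<Prod>r\<in>{1..?D}. [:1, - 1 / of_nat r:])"
  obtain \<alpha> where \<alpha>: "\<And>x y. x \<in> V \<Longrightarrow> y \<in> V \<Longrightarrow>
      poly \<delta> (of_nat (gdist adj x y)) = (\<Sum>i\<le>?D. \<alpha> i * E i x y)"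
    using poly_gdist_in_span[OF Q \<theta> lin \<open>\<xi> \<noteq> 0\<close>] by metis
  have \<delta>: "poly \<delta> (of_nat (gdist adj x y)) = of_bool (x = y)" if "x \<in> V" "y \<in> V" for x y
  proof (cases "x = y")
    case True
    then show ?thesis using that by (simp add: \<delta>_def poly_prod gdist_eq_0_iff[THEN iffD2])
  next
    case False
    then have "gdist adj x y \<in> {1..?D}"
      using gdist_eq_0_iff[OF that] gdist_le_diam[OF that] by simp
    then have "poly \<delta> (of_nat (gdist adj x y)) = 0"
      unfolding \<delta>_def poly_prod by (intro prod_zero bexI[of _ "gdist adj x y"]) auto
    then show ?thesis using False by simp
  qed
  have "\<exists>P. degree P \<le> i \<and> (\<forall>x\<in>V. \<forall>y\<in>V. E i x y = poly P (of_nat (gdist adj x y)))"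
    if "i \<le> ?D" for i
    using idempotent_poly_gdist[OF Q \<theta> lin that] .
  then obtain R where R: "\<And>i. i \<le> ?D \<Longrightarrow> degree (R i) \<le> i"
    "\<And>i x y. i \<le> ?D \<Longrightarrow> x \<in> V \<Longrightarrow> y \<in> V \<Longrightarrow> E i x y = poly (R i) (of_nat (gdist adj x y))"
    by metis
  define P where "P = (\<Sum>i\<in>{i. i \<le> ?D \<and> i \<le> s}. smult (\<alpha> i) (R i))"
  show ?thesis
  proof (intro exI[of _ P] conjI ballI)
    show "degree P \<le> s"
      unfolding P_def
      by (intro degree_sum_le order_trans[OF degree_smult_le]) (auto intro: order_trans[OF R(1)])
    fix x assume x: "x \<in> V"
    have "(of_bool (x \<in> Y) :: complex) = (\<Sum>y\<in>Y. of_bool (x = y))"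
      using finite_subset[OF Y finite_V] by (simp add: of_bool_def)
    also have "\<dots> = (\<Sum>y\<in>Y. \<Sum>i\<le>?D. \<alpha> i * E i x y)"
    proof (rule sum.cong[OF refl])
      fix y assume "y \<in> Y"
      then have "y \<in> V" using Y by blast
      then show "of_bool (x = y) = (\<Sum>i\<le>?D. \<alpha> i * E i x y)"
        using \<alpha>[OF x] \<delta>[OF x] by simp
    qed
    also have "\<dots> = (\<Sum>i\<le>?D. \<alpha> i * (\<Sum>y\<in>Y. E i x y))"
      by (subst sum.swap) (simp add: sum_distrib_left)
    also have "\<dots> = (\<Sum>i\<in>{i. i \<le> ?D \<and> i \<le> s}. \<alpha> i * (\<Sum>y\<in>Y. E i x y))"
    proof (rule sum.mono_neutral_right)
      show "\<forall>i\<in>{..?D} - {i. i \<le> ?D \<and> i \<le> s}. \<alpha> i * (\<Sum>y\<in>Y. E i x y) = 0"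
      proof
        fix i assume i: "i \<in> {..?D} - {i. i \<le> ?D \<and> i \<le> s}"
        then have "E i \<in> primitive_idempotents V adj"
          using Q by (auto simp: Q_polynomial_def idempotent_ordering_def bij_betw_def)
        then show "\<alpha> i * (\<Sum>y\<in>Y. E i x y) = 0"
          using primitive_kernel[OF _ s Y] i by auto
      qed
    qed auto
    also have "\<dots> = (\<Sum>i\<in>{i. i \<le> ?D \<and> i \<le> s}. \<Sum>y\<in>Y. \<alpha> i * poly (R i) (of_nat (gdist adj x y)))"
      unfolding sum_distrib_left using R(2)[OF _ x] Y by (intro sum.cong) auto
    also have "\<dots> = (\<Sum>y\<in>Y. poly P (of_nat (gdist adj x y)))"
      unfolding P_def poly_sum by (subst sum.swap) simp
    finally show "(of_bool (x \<in> Y) :: complex) = (\<Sum>y\<in>Y. poly P (of_nat (gdist adj x y)))" .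
  qed
qed

end

section \<open>The Bose--Mesner algebra of the halved cube\<close>

text \<open>A bijection from \<open>A\<close> to \<open>B\<close> is glued to one between the
  complements.\<close>

lemma ex_bij_image_eq:
  fixes A B :: "'n :: finite set"
  assumes "card A = card B"
  obtains \<pi> where "bij \<pi>" "\<pi> ` A = B"
proof -
  have "card (- A) = card (- B)"
    using assms by (simp add: Compl_eq_Diff_UNIV card_Diff_subset)
  then obtain f g where f: "bij_betw f A B" and g: "bij_betw g (- A) (- B)"
    using assms by (metis finite finite_same_card_bij)
  let ?\<pi> = "\<lambda>x. if x \<in> A then f x else g x"
  have f': "bij_betw ?\<pi> A B" by (rule bij_betw_cong[THEN iffD1, OF _ f]) simp
  have g': "bij_betw ?\<pi> (- A) (- B)" by (rule bij_betw_cong[THEN iffD1, OF _ g]) simp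
  have "bij ?\<pi>" using bij_betw_combine[OF f' g'] by simp
  moreover have "?\<pi> ` A = B" using f' by (simp only: bij_betw_def)
  ultimately show thesis by (rule that)
qed

lemma bij_betw_flip:
  assumes "x \<in> halved_cube_vertices \<epsilon>"
  shows "bij_betw (flip x) {S. even (card S)} (halved_cube_vertices \<epsilon>)"
proof (rule bij_betw_byWitness[where f' = "diff_set x"])
  have V: "y \<in> halved_cube_vertices \<epsilon> \<longleftrightarrow> even (card (diff_set x y))" for y
    by (rule even_card_diff_set[OF assms])
  show "flip x ` {S. even (card S)} \<subseteq> halved_cube_vertices \<epsilon>"
    by (simp add: image_subset_iff V diff_set_flip)
  show "diff_set x ` halved_cube_vertices \<epsilon> \<subseteq> {S. even (card S)}"
    by (simp add: image_subset_iff V)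
qed (simp_all add: diff_set_flip flip_diff_set)

lemma diff_set_flip_left: "diff_set (flip x S) y = sym_diff S (diff_set x y)"
  by (metis diff_set_commute diff_set_flip diff_set_sym_diff)

text \<open>An entry of a product is a sum over even sets that depends only on the difference set of
  its two indices. Permuting the coordinates shows that only the size of this set matters, hence
  only the distance.\<close>

lemma bose_mesner_algebra_halved_cube:
  "bose_mesner_algebra (halved_cube_vertices \<epsilon> :: (bit ^ 'n) set) (halved_cube_adj \<epsilon>)"
proof -
  let ?V = "halved_cube_vertices \<epsilon> :: (bit ^ 'n) set"
  interpret finite_connected_graph ?V "halved_cube_adj \<epsilon>"
    by unfold_locales (rule halved_cube_connected)
  have dist: "gdist (halved_cube_adj \<epsilon>) x y = card (diff_set x y) div 2"
    if "x \<in> ?V" "y \<in> ?V" for x y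
    using gdist_halved_cube[OF that] by simp
  show ?thesis
  proof
    fix M N
    assume "M \<in> bose_mesner ?V (halved_cube_adj \<epsilon>)" "N \<in> bose_mesner ?V (halved_cube_adj \<epsilon>)"
    then obtain k l where
      M: "M = (\<lambda>x y. if x \<in> ?V \<and> y \<in> ?V then k (gdist (halved_cube_adj \<epsilon>) x y) else 0)" and
      N: "N = (\<lambda>x y. if x \<in> ?V \<and> y \<in> ?V then l (gdist (halved_cube_adj \<epsilon>) x y) else 0)"
      by (auto simp: bose_mesner_iff)
    \<comment> \<open>For \<open>z = flip x S\<close> and \<open>D = diff_set x y\<close>, the sets
      \<open>S\<close> and \<open>sym_diff S D\<close> are the differences from \<open>x\<close> to
      \<open>z\<close> and from \<open>z\<close> to \<open>y\<close>.\<close>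
    define F where
      "F D = (\<Sum>S | even (card S). k (card S div 2) * l (card (sym_diff S D) div 2))"
      for D :: "'n set"
    have F: "F C = F D" if CD: "card C = card D" for C D
    proof -
      obtain \<pi> where \<pi>: "bij \<pi>" "\<pi> ` C = D" using ex_bij_image_eq[OF CD] .
      then have inj: "inj \<pi>" by (simp add: bij_is_inj)
      have card_image_inj: "card (f ` S) = card S" if "inj f" for f :: "'n \<Rightarrow> 'n" and S
        using that by (intro card_image inj_on_subset[OF that]) simp
      have "bij_betw ((`) \<pi>) {S. even (card S)} {S. even (card S)}"
      proof (rule bij_betw_byWitness[where f' = "(`) (inv \<pi>)"])
        show "(`) \<pi> ` {S. even (card S)} \<subseteq> {S. even (card S)}"
          using inj by (auto simp: card_image_inj)
        have "inj (inv \<pi>)" using \<pi>(1) by (simp add: bij_imp_bij_inv bij_is_inj)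
        then show "(`) (inv \<pi>) ` {S. even (card S)} \<subseteq> {S. even (card S)}"
          by (auto simp: card_image_inj)
      qed (use \<pi>(1) in \<open>auto simp: image_inv_f_f image_f_inv_f bij_is_inj bij_is_surj\<close>)
      then have "F D = (\<Sum>S | even (card S).
          k (card (\<pi> ` S) div 2) * l (card (sym_diff (\<pi> ` S) D) div 2))"
        unfolding F_def by (rule sum.reindex_bij_betw[symmetric])
      also have "\<dots> = F C"
        unfolding F_def \<pi>(2)[symmetric] image_set_diff[OF inj, symmetric] image_Un[symmetric]
        by (simp only: card_image_inj[OF inj])
      finally show ?thesis by simp
    qed
    have MN: "mat_mult ?V M N x y = F (diff_set x y)" if xy: "x \<in> ?V" "y \<in> ?V" for x y
    proof -
      have "mat_mult ?V M N x y =
          (\<Sum>z\<in>?V. k (card (diff_set x z) div 2) * l (card (diff_set z y) div 2))"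
        unfolding mat_mult_def using xy by (intro sum.cong) (auto simp: M N dist)
      also have "\<dots> = F (diff_set x y)"
        unfolding F_def
        by (subst sum.reindex_bij_betw[OF bij_betw_flip[OF xy(1)], symmetric])
          (simp add: diff_set_flip diff_set_flip_left)
      finally show ?thesis .
    qed
    \<comment> \<open>As \<open>F\<close> depends only on the size, any set whose size is twice the
      distance can be the argument; \<open>SOME\<close> picks one.\<close>
    have "mat_mult ?V M N = (\<lambda>x y. if x \<in> ?V \<and> y \<in> ?V
        then F (SOME D. card D = 2 * gdist (halved_cube_adj \<epsilon>) x y) else 0)"
    proof (intro ext)
      fix x y
      show "mat_mult ?V M N x y = (if x \<in> ?V \<and> y \<in> ?V
        then F (SOME D. card D = 2 * gdist (halved_cube_adj \<epsilon>) x y) else 0)"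
      proof (cases "x \<in> ?V \<and> y \<in> ?V")
        case True
        then have g: "card (diff_set x y) = 2 * gdist (halved_cube_adj \<epsilon>) x y"
          using gdist_halved_cube[of x \<epsilon> y] by simp
        have "card (SOME D :: 'n set. card D = 2 * gdist (halved_cube_adj \<epsilon>) x y) =
            2 * gdist (halved_cube_adj \<epsilon>) x y"
          by (rule someI[of "\<lambda>D :: 'n set. card D = 2 * gdist (halved_cube_adj \<epsilon>) x y", OF g])
        then have "F (SOME D. card D = 2 * gdist (halved_cube_adj \<epsilon>) x y) = F (diff_set x y)"
          using g by (intro F) simp
        then show ?thesis using MN[of x y] True by simp
      next
        case False
        then show ?thesis by (auto simp: mat_mult_def M N)
      qed
    qed
    then show "mat_mult ?V M N \<in> bose_mesner ?V (halved_cube_adj \<epsilon>)"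
      unfolding bose_mesner_iff by (intro exI[of _ "\<lambda>i. F (SOME D. card D = 2 * i)"]) simp
  qed
qed

section \<open>Averages of polynomial set functions\<close>

text \<open>These are the polynomials of degree at most \<open>s\<close> in the 0/1 coordinates of
  \<open>S\<close>, spanned by the squarefree monomials \<open>of_bool (K \<subseteq> S)\<close>.
  The inductive form reduces linear statements to monomials.\<close>

inductive set_poly :: "nat \<Rightarrow> ('n set \<Rightarrow> complex) \<Rightarrow> bool" for s where
  monom: "finite K \<Longrightarrow> card K \<le> s \<Longrightarrow> set_poly s (\<lambda>S. of_bool (K \<subseteq> S))"
| scale: "set_poly s g \<Longrightarrow> set_poly s (\<lambda>S. c * g S)"
| add: "set_poly s g \<Longrightarrow> set_poly s h \<Longrightarrow> set_poly s (\<lambda>S. g S + h S)"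

lemma set_poly_const: "set_poly s (\<lambda>S. c)"
  using set_poly.scale[OF set_poly.monom[of "{}" s], of c] by simp

lemma set_poly_sum:
  assumes "finite I" "\<And>i. i \<in> I \<Longrightarrow> set_poly s (g i)"
  shows "set_poly s (\<lambda>S. \<Sum>i\<in>I. g i S)"
  using assms by (induction I rule: finite_induct) (auto intro: set_poly_const set_poly.add)

lemma set_poly_mono: "set_poly s g \<Longrightarrow> s \<le> t \<Longrightarrow> set_poly t g"
  by (induction rule: set_poly.induct) (auto intro: set_poly.intros)

text \<open>A 0/1 variable equals its square, so multiplying the monomial of \<open>K\<close> by the
  variable of \<open>i\<close> gives the monomial of \<open>insert i K\<close>.\<close>

lemma set_poly_mult_mem: "set_poly s g \<Longrightarrow> set_poly (Suc s) (\<lambda>S. of_bool (i \<in> S) * g S)"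
proof (induction rule: set_poly.induct)
  case (monom K)
  have "(\<lambda>S. of_bool (i \<in> S) * of_bool (K \<subseteq> S)) = (\<lambda>S. of_bool (insert i K \<subseteq> S) :: complex)"
    by auto
  moreover have "card (insert i K) \<le> Suc s"
    using monom by (simp add: card_insert_if)
  ultimately show ?case using set_poly.monom[of "insert i K"] monom by simp
next
  case (scale g c)
  then show ?case using set_poly.scale[of "Suc s" "\<lambda>S. of_bool (i \<in> S) * g S" c]
    by (simp add: algebra_simps)
next
  case (add g h)
  then show ?case using set_poly.add by (simp add: distrib_left)
qed

text \<open>The size of the symmetric difference is affine in the coordinates: a point of
  \<open>D\<close> contributes 1 minus its variable, any other point its variable.\<close>

lemma set_poly_mult_card_sym_diff:
  fixes D :: "'n :: finite set"
  assumes "set_poly s g"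
  shows "set_poly (Suc s) (\<lambda>S. of_nat (card (sym_diff S D)) * g S)"
proof -
  have card: "(of_nat (card A) :: complex) = (\<Sum>i\<in>UNIV. of_bool (i \<in> A))" for A :: "'n set"
    by simp
  have "of_nat (card (sym_diff S D)) * g S = of_nat (card D) * g S +
      (\<Sum>i\<in>UNIV. (if i \<in> D then - 1 else 1) * (of_bool (i \<in> S) * g S))" for S
    unfolding card sum_distrib_right sum.distrib[symmetric] by (intro sum.cong) auto
  moreover have "set_poly (Suc s) (\<lambda>S. of_nat (card D) * g S +
      (\<Sum>i\<in>UNIV. (if i \<in> D then - 1 else 1) * (of_bool (i \<in> S) * g S)))"
    using set_poly_mono[OF assms, of "Suc s"]
    by (intro set_poly.add set_poly_sum set_poly.scale set_poly_mult_mem assms) auto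
  ultimately show ?thesis by simp
qed

text \<open>Horner's scheme raises the degree by one per coefficient. Halving turns the size of a
  symmetric difference into the graph distance.\<close>

lemma set_poly_poly_card_sym_diff:
  fixes D :: "'n :: finite set"
  assumes "degree P \<le> s"
  shows "set_poly s (\<lambda>S. poly P (of_nat (card (sym_diff S D)) / 2))"
  using assms
proof (induction P arbitrary: s)
  case 0
  show ?case using set_poly_const[of s 0] by simp
next
  case (pCons a P)
  show ?case
  proof (cases "P = 0")
    case True
    then show ?thesis using set_poly_const[of s a] by simp
  next
    case False
    then obtain t where t: "s = Suc t" "degree P \<le> t"
      using pCons.prems by (cases s) auto
    show ?thesis
      using set_poly.add[OF set_poly_const[of "Suc t" a]
          set_poly.scale[OF set_poly_mult_card_sym_diff[OF pCons.IH[OF t(2)], of D], of "1/2"]]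
      by (simp add: t(1))
  qed
qed

section \<open>Polynomials in two variables and their forced zeros\<close>

text \<open>\<open>G\<close> is a polynomial in two variables of total degree at most \<open>s\<close>.\<close>

definition bipoly :: "nat \<Rightarrow> (complex \<Rightarrow> complex \<Rightarrow> complex) \<Rightarrow> bool" where
  "bipoly s G \<longleftrightarrow> (\<exists>h. (\<forall>j\<le>s. degree (h j) \<le> s - j) \<and>
     (\<forall>p q. G p q = (\<Sum>j\<le>s. poly (h j) p * q ^ j)))"

lemma bipoly_scale:
  assumes "bipoly s G"
  shows "bipoly s (\<lambda>p q. c * G p q)"
proof -
  obtain h where "\<forall>j\<le>s. degree (h j) \<le> s - j" "\<forall>p q. G p q = (\<Sum>j\<le>s. poly (h j) p * q ^ j)"
    using assms unfolding bipoly_def by blast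
  then show ?thesis
    unfolding bipoly_def
    by (intro exI[of _ "\<lambda>j. smult c (h j)"])
      (auto simp: sum_distrib_left mult.assoc intro: order_trans[OF degree_smult_le])
qed

lemma bipoly_add:
  assumes "bipoly s G" "bipoly s H"
  shows "bipoly s (\<lambda>p q. G p q + H p q)"
proof -
  obtain h k where "\<forall>j\<le>s. degree (h j) \<le> s - j" "\<forall>p q. G p q = (\<Sum>j\<le>s. poly (h j) p * q ^ j)"
    "\<forall>j\<le>s. degree (k j) \<le> s - j" "\<forall>p q. H p q = (\<Sum>j\<le>s. poly (k j) p * q ^ j)"
    using assms unfolding bipoly_def by blast
  then show ?thesis
    unfolding bipoly_def
    by (intro exI[of _ "\<lambda>j. h j + k j"])
      (auto simp: sum.distrib distrib_right intro: degree_add_le)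
qed

lemma poly_eq_sum_upto:
  fixes P :: "'a :: comm_semiring_1 poly"
  assumes "degree P \<le> s"
  shows "poly P x = (\<Sum>j\<le>s. coeff P j * x ^ j)"
proof -
  have "(\<Sum>j\<le>degree P. coeff P j * x ^ j) = (\<Sum>j\<le>s. coeff P j * x ^ j)"
    using assms by (intro sum.mono_neutral_left) (auto simp: coeff_eq_0)
  then show ?thesis by (simp add: poly_altdef)
qed

lemma bipoly_mult:
  assumes "degree P + degree Q \<le> s"
  shows "bipoly s (\<lambda>p q. poly P p * poly Q q)"
  unfolding bipoly_def
proof (intro exI conjI allI impI)
  show "degree (smult (coeff Q j) P) \<le> s - j" if "j \<le> s" for j
    using assms that by (cases "j \<le> degree Q") (auto simp: coeff_eq_0)
  show "poly P p * poly Q q = (\<Sum>j\<le>s. poly (smult (coeff Q j) P) p * q ^ j)" for p q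
    using assms by (subst poly_eq_sum_upto[of Q s]) (auto simp: sum_distrib_left mult_ac)
qed

lemma poly_eq_0_many_roots:
  fixes P :: "'a :: idom poly"
  assumes "\<And>x. x \<in> A \<Longrightarrow> poly P x = 0" "degree P < card A"
  shows "P = 0"
proof (rule ccontr)
  assume "P \<noteq> 0"
  then have "card A \<le> card {x. poly P x = 0}"
    using assms(1) by (intro card_mono poly_roots_finite) auto
  then show False using card_poly_roots_bound[OF \<open>P \<noteq> 0\<close>] assms(2) by simp
qed

lemma bipoly_section:
  assumes "bipoly s G"
  obtains P where "degree P \<le> s" "\<And>q. G p q = poly P q"
proof -
  obtain h where h: "\<forall>p q. G p q = (\<Sum>j\<le>s. poly (h j) p * q ^ j)"
    using assms unfolding bipoly_def by blast
  show thesis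
  proof (rule that[of "\<Sum>j\<le>s. monom (poly (h j) p) j"])
    show "degree (\<Sum>j\<le>s. monom (poly (h j) p) j) \<le> s"
      by (intro degree_sum_le) (auto intro: order_trans[OF degree_monom_le])
  qed (simp add: h poly_sum poly_monom)
qed

text \<open>Each pair of lines \<open>p = 2 * i\<close>, \<open>p = 2 * w - 2 * i\<close> on which \<open>H\<close> is shown to vanish lowers
  the possible degree in \<open>q\<close> on the next pair by two, while the number of prescribed zeros there
  drops only by one.\<close>

lemma bipoly_vanishes:
  assumes H: "bipoly s H" and "w \<ge> 1"
    and zeros: "\<And>i r. 2 * i \<le> w \<Longrightarrow> i < r \<Longrightarrow> r \<le> s \<Longrightarrow>
      H (of_nat (2 * i)) (of_nat (2 * r)) = 0 \<and> H (of_nat (2 * w - 2 * i)) (of_nat (2 * r)) = 0"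
    and "H 0 0 = 0" "H (of_nat (2 * w)) 0 = 0"
    and "2 * i \<le> w"
  shows "H (of_nat (2 * i)) q = 0 \<and> H (of_nat (2 * w - 2 * i)) q = 0"
proof -
  obtain h where deg: "\<And>j. j \<le> s \<Longrightarrow> degree (h j) \<le> s - j"
    and h: "\<And>p q. H p q = (\<Sum>j\<le>s. poly (h j) p * q ^ j)"
    using H unfolding bipoly_def by blast
  have "\<forall>p\<in>{2 * i, 2 * w - 2 * i}. \<forall>j\<le>s. poly (h j) (of_nat p) = 0"
    using \<open>2 * i \<le> w\<close>
  proof (induction i rule: less_induct)
    case (less i)
    \<comment> \<open>The earlier pairs of lines supply \<open>2 * i\<close> distinct zeros of
      \<open>h j\<close>, more than its degree, which is at most \<open>s - j\<close>.\<close>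
    have small: "h j = 0" if j: "j \<le> s" "s < j + 2 * i" for j
    proof (rule poly_eq_0_many_roots)
      let ?A = "(\<lambda>k. 2 * k) ` {..<i}" and ?B = "(\<lambda>k. 2 * w - 2 * k) ` {..<i}"
      show "poly (h j) x = 0" if "x \<in> of_nat ` (?A \<union> ?B)" for x
        using that less j by fastforce
      have "card (?A \<union> ?B) = card ?A + card ?B"
        using less.prems by (intro card_Un_disjoint) auto
      moreover have "card ?A = i" by (simp add: card_image inj_on_def)
      moreover have "card ?B = i"
      proof -
        have "inj_on (\<lambda>k. 2 * w - 2 * k) {..<i}"
          using less.prems by (intro inj_onI) auto
        then show ?thesis by (simp add: card_image)
      qed
      ultimately have "card (of_nat ` (?A \<union> ?B) :: complex set) = 2 * i"
        by (subst card_image) (auto simp: inj_on_def)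
      then show "degree (h j) < card (of_nat ` (?A \<union> ?B) :: complex set)"
        using deg[OF j(1)] j by linarith
    qed
    show ?case
    proof
      fix p assume p: "p \<in> {2 * i, 2 * w - 2 * i}"
      define P where "P = (\<Sum>j\<le>s. monom (poly (h j) (of_nat p)) j)"
      have coeff: "coeff P j = (if j \<le> s then poly (h j) (of_nat p) else 0)" for j
        by (simp add: P_def coeff_sum)
      have poly: "poly P q = H (of_nat p) q" for q
        by (simp add: P_def h poly_sum poly_monom)
      have "P = 0"
      proof (cases "i = 0")
        case True
        \<comment> \<open>On the first pair of lines \<open>q = 0\<close> is a zero as well, giving
          \<open>s + 1\<close> zeros against degree at most \<open>s\<close>.\<close>
        show ?thesis
        proof (rule poly_eq_0_many_roots)
          show "poly P x = 0" if x: "x \<in> (\<lambda>r. of_nat (2 * r)) ` {..s}" for x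
          proof -
            obtain r where r: "x = of_nat (2 * r)" "r \<in> {..s}" using x by blast
            show ?thesis
              using zeros[of 0 r] r p True assms(4,5) by (cases "r = 0") (auto simp: poly)
          qed
          have "degree P \<le> s" by (rule degree_le) (simp add: coeff)
          moreover have "card ((\<lambda>r. of_nat (2 * r) :: complex) ` {..s}) = Suc s"
            by (subst card_image) (auto simp: inj_on_def)
          ultimately show "degree P < card ((\<lambda>r. of_nat (2 * r) :: complex) ` {..s})" by simp
        qed
      next
        case False
        show ?thesis
        \<comment> \<open>By \<open>small\<close> no coefficient beyond \<open>s - 2 * i\<close>
          survives, while \<open>s - i\<close> zeros are known; if \<open>2 * i\<close> exceeds
          \<open>s\<close>, no coefficient survives at all.\<close>
        proof (cases "2 * i \<le> s")
          case True
          show ?thesis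
          proof (rule poly_eq_0_many_roots)
            show "poly P x = 0" if "x \<in> (\<lambda>r. of_nat (2 * r)) ` {i<..s}" for x
              using that zeros[OF less.prems] p by (auto simp: poly)
            have "degree P \<le> s - 2 * i"
              by (rule degree_le) (use small True in \<open>auto simp: coeff\<close>)
            moreover have "card ((\<lambda>r. of_nat (2 * r) :: complex) ` {i<..s}) = s - i"
              by (subst card_image) (auto simp: inj_on_def)
            ultimately show "degree P < card ((\<lambda>r. of_nat (2 * r) :: complex) ` {i<..s})"
              using True False by simp
          qed
        next
          case False
          then show ?thesis by (intro poly_eqI) (simp add: coeff small)
        qed
      qed
      then show "\<forall>j\<le>s. poly (h j) (of_nat p) = 0" using coeff by (metis coeff_0)
    qed
  qed
  then show ?thesis by (simp add: h)
qed

section \<open>Class sums as polynomials in the intersection sizes\<close>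

lemma degree_prod_linear_le:
  assumes "finite A" "\<And>i. i \<in> A \<Longrightarrow> degree (f i) \<le> 1"
  shows "degree (\<Prod>i\<in>A. f i) \<le> card A"
proof -
  have "degree (\<Prod>i\<in>A. f i) \<le> sum (degree \<circ> f) A"
    using assms(1) by (rule degree_prod_sum_le)
  also have "\<dots> \<le> card A"
    using sum_mono[of A "degree \<circ> f" "\<lambda>_. 1"] assms(2) by simp
  finally show ?thesis .
qed

lemma ex_poly_gchoose:
  obtains P :: "complex poly" where "degree P \<le> k" "\<And>x. poly P x = x gchoose k"
proof (rule that)
  let ?P = "smult (1 / fact k) (\<Prod>i\<in>{0..<k}. [:- of_nat i, 1:]) :: complex poly"
  have "degree (\<Prod>i\<in>{0..<k}. [:- of_nat i, 1:] :: complex poly) \<le> card {0..<k}"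
    by (rule degree_prod_linear_le) auto
  then show "degree ?P \<le> k" by simp
  show "poly ?P x = x gchoose k" for x
    by (simp add: gbinomial_prod_rev poly_prod)
qed

text \<open>There are \<open>(card T - card K) choose (p - card K)\<close> such sets if
  \<open>card K \<le> p\<close>. In the cross-multiplied form their proportion among the
  \<open>p\<close>-subsets of \<open>T\<close> is visibly \<open>p choose card K\<close> over a
  constant, a polynomial in \<open>p\<close>.\<close>

lemma card_supersets:
  assumes "finite T" "K \<subseteq> T" "p \<le> card T"
  shows "card {A. A \<subseteq> T \<and> card A = p \<and> K \<subseteq> A} * (card T choose card K) =
    (card T choose p) * (p choose card K)"
proof (cases "card K \<le> p")
  case True
  have fK: "finite K" using assms finite_subset by blast
  have "bij_betw (\<lambda>B. B \<union> K) {B. B \<subseteq> T - K \<and> card B = p - card K}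
      {A. A \<subseteq> T \<and> card A = p \<and> K \<subseteq> A}"
  proof (rule bij_betw_byWitness[where f' = "\<lambda>A. A - K"])
    show "(\<lambda>B. B \<union> K) ` {B. B \<subseteq> T - K \<and> card B = p - card K} \<subseteq>
        {A. A \<subseteq> T \<and> card A = p \<and> K \<subseteq> A}"
    proof (intro image_subsetI CollectI conjI)
      fix B assume B: "B \<in> {B. B \<subseteq> T - K \<and> card B = p - card K}"
      then have "finite B" using assms finite_subset by blast
      then show "card (B \<union> K) = p" using B fK True by (subst card_Un_disjoint) auto
    qed (use assms in auto)
    show "(\<lambda>A. A - K) ` {A. A \<subseteq> T \<and> card A = p \<and> K \<subseteq> A} \<subseteq>
        {B. B \<subseteq> T - K \<and> card B = p - card K}"
      using fK by (auto simp: card_Diff_subset)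
  qed auto
  then have "card {A. A \<subseteq> T \<and> card A = p \<and> K \<subseteq> A} = (card T - card K) choose (p - card K)"
    using assms fK by (simp add: bij_betw_same_card[symmetric] n_subsets card_Diff_subset)
  then show ?thesis using choose_mult[OF True assms(3)] by simp
next
  case False
  have "\<not> (A \<subseteq> T \<and> card A = p \<and> K \<subseteq> A)" for A
    using False card_mono[of A K] finite_subset[of A T] assms(1) by blast
  then have "{A. A \<subseteq> T \<and> card A = p \<and> K \<subseteq> A} = {}" by blast
  moreover have "p choose card K = 0" using False by simp
  ultimately show ?thesis by (simp only: card.empty mult_0 mult_0_right)
qed

text \<open>The binomial prefactor is the number of sets in the class, so \<open>G\<close> is the
  class average. For a monomial it is, up to a constant, a product of binomial polynomials of degree
  \<open>card (K \<inter> T)\<close> in \<open>p\<close> and \<open>card (K - T)\<close> in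
  \<open>q\<close>; the rest is linearity.\<close>

lemma set_poly_class_sum:
  fixes T :: "'n :: finite set"
  assumes "set_poly s g"
  shows "\<exists>G. bipoly s G \<and> (\<forall>p \<le> card T. \<forall>q \<le> card (- T).
    (\<Sum>S | card (S \<inter> T) = p \<and> card (S - T) = q. g S) =
      of_nat ((card T choose p) * (card (- T) choose q)) * G (of_nat p) (of_nat q))"
  using assms
proof (induction rule: set_poly.induct)
  case (monom K)
  let ?c1 = "card (K \<inter> T)" and ?c2 = "card (K - T)"
  obtain P where P: "degree P \<le> ?c1" "\<And>x. poly P x = (x :: complex) gchoose ?c1"
    using ex_poly_gchoose by blast
  obtain Q where Q: "degree Q \<le> ?c2" "\<And>x. poly Q x = (x :: complex) gchoose ?c2"
    using ex_poly_gchoose by blast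
  let ?c = "1 / of_nat ((card T choose ?c1) * (card (- T) choose ?c2)) :: complex"
  have "?c1 + ?c2 = card K"
    using card_Int_Diff[OF monom(1), of T] by simp
  then have "bipoly s (\<lambda>p q. ?c * (poly P p * poly Q q))"
    using P(1) Q(1) monom by (intro bipoly_scale bipoly_mult) linarith
  moreover have "(\<Sum>S | card (S \<inter> T) = p \<and> card (S - T) = q. of_bool (K \<subseteq> S)) =
      of_nat ((card T choose p) * (card (- T) choose q)) *
        (?c * (poly P (of_nat p) * poly Q (of_nat q)))"
    if pq: "p \<le> card T" "q \<le> card (- T)" for p q
  proof -
    let ?A = "{A. A \<subseteq> T \<and> card A = p \<and> K \<inter> T \<subseteq> A}"
    let ?B = "{B. B \<subseteq> - T \<and> card B = q \<and> K - T \<subseteq> B}"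
    have A: "card ?A * (card T choose ?c1) = (card T choose p) * (p choose ?c1)"
      using pq by (intro card_supersets) auto
    have B: "card ?B * (card (- T) choose ?c2) = (card (- T) choose q) * (q choose ?c2)"
      using pq by (intro card_supersets) auto
    have AB: "card (?A \<times> ?B) * ((card T choose ?c1) * (card (- T) choose ?c2)) =
        ((card T choose p) * (card (- T) choose q)) * ((p choose ?c1) * (q choose ?c2))"
      using arg_cong2[OF A B, of "(*)"] by (simp add: card_cartesian_product mult_ac)
    have "bij_betw (\<lambda>(A, B). A \<union> B) (?A \<times> ?B)
        {S. (card (S \<inter> T) = p \<and> card (S - T) = q) \<and> K \<subseteq> S}"
    proof (rule bij_betw_byWitness[where f' = "\<lambda>S. (S \<inter> T, S - T)"])
      show "\<forall>AB\<in>?A \<times> ?B. (\<lambda>S. (S \<inter> T, S - T)) ((\<lambda>(A, B). A \<union> B) AB) = AB" by auto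
      have *: "(A \<union> B) \<inter> T = A" "(A \<union> B) - T = B" if "A \<subseteq> T" "B \<subseteq> - T" for A B
        using that by auto
      show "(\<lambda>(A, B). A \<union> B) ` (?A \<times> ?B) \<subseteq>
          {S. (card (S \<inter> T) = p \<and> card (S - T) = q) \<and> K \<subseteq> S}"
        by (auto simp: *)
    qed auto
    then have "card {S. (card (S \<inter> T) = p \<and> card (S - T) = q) \<and> K \<subseteq> S} = card (?A \<times> ?B)"
      by (simp add: bij_betw_same_card)
    moreover have "{S. (card (S \<inter> T) = p \<and> card (S - T) = q) \<and> K \<subseteq> S} =
        {S. card (S \<inter> T) = p \<and> card (S - T) = q} \<inter> {S. K \<subseteq> S}"
      by blast
    ultimately have "card ({S. card (S \<inter> T) = p \<and> card (S - T) = q} \<inter> {S. K \<subseteq> S}) =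
        card (?A \<times> ?B)"
      by metis
    then have "(\<Sum>S | card (S \<inter> T) = p \<and> card (S - T) = q. of_bool (K \<subseteq> S)) =
        (of_nat (card (?A \<times> ?B)) :: complex)"
      by (subst sum_of_bool_eq) (rule finite, rule arg_cong)
    also have "\<dots> = of_nat (card (?A \<times> ?B) * ((card T choose ?c1) * (card (- T) choose ?c2))) * ?c"
    proof -
      have "?c1 \<le> card T" "?c2 \<le> card (- T)" by (auto intro: card_mono)
      then have "(card T choose ?c1) * (card (- T) choose ?c2) \<noteq> 0" by simp
      then show ?thesis by (simp only: of_nat_mult) simp
    qed
    also have "\<dots> = of_nat ((card T choose p) * (card (- T) choose q)) *
        (?c * (poly P (of_nat p) * poly Q (of_nat q)))"
      unfolding AB P(2) Q(2) binomial_gbinomial[symmetric] by (simp only: of_nat_mult mult_ac)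
    finally show ?thesis .
  qed
  ultimately show ?case by blast
next
  case (scale g c)
  then obtain G where "bipoly s G" "\<forall>p \<le> card T. \<forall>q \<le> card (- T).
      (\<Sum>S | card (S \<inter> T) = p \<and> card (S - T) = q. g S) =
      of_nat ((card T choose p) * (card (- T) choose q)) * G (of_nat p) (of_nat q)"
    by blast
  then show ?case
    by (intro exI[of _ "\<lambda>p q. c * G p q"])
      (auto intro!: bipoly_scale simp: sum_distrib_left[symmetric] mult_ac)
next
  case (add g h)
  then obtain G H where "bipoly s G" "\<forall>p \<le> card T. \<forall>q \<le> card (- T).
      (\<Sum>S | card (S \<inter> T) = p \<and> card (S - T) = q. g S) =
      of_nat ((card T choose p) * (card (- T) choose q)) * G (of_nat p) (of_nat q)"
    "bipoly s H" "\<forall>p \<le> card T. \<forall>q \<le> card (- T).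
      (\<Sum>S | card (S \<inter> T) = p \<and> card (S - T) = q. h S) =
      of_nat ((card T choose p) * (card (- T) choose q)) * H (of_nat p) (of_nat q)"
    by blast
  then show ?case
    by (intro exI[of _ "\<lambda>p q. G p q + H p q"])
      (auto intro!: bipoly_add simp: sum.distrib distrib_left)
qed

section \<open>Valency and convexity\<close>

text \<open>A member \<open>S\<close> of \<open>F\<close> stands for the vertex \<open>flip x S\<close> of \<open>Y\<close>, where \<open>x\<close> is a fixed base
  vertex in \<open>Y\<close>; graph distance is half the cardinality of the symmetric difference.\<close>

locale width_family =
  fixes F :: "'n :: finite set set" and g :: "'n set \<Rightarrow> complex" and w s :: nat
  assumes set_poly_g: "set_poly s g"
    and g_eq: "\<And>S. even (card S) \<Longrightarrow> g S = of_bool (S \<in> F)"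
    and even_card: "\<And>S. S \<in> F \<Longrightarrow> even (card S)"
    and card_sym_diff_le: "\<And>S R. S \<in> F \<Longrightarrow> R \<in> F \<Longrightarrow> card (sym_diff S R) \<le> 2 * w"
    and empty_mem: "{} \<in> F"
    and w_pos: "1 \<le> w"
    and le_card: "2 * (w + s) \<le> CARD('n)"
begin

lemma card_mem_le: "S \<in> F \<Longrightarrow> card S \<le> 2 * w"
  using card_sym_diff_le[OF _ empty_mem] by simp

text \<open>For even \<open>p\<close> and \<open>q\<close> all sets of the class have even size,
  where \<open>g\<close> is the indicator of \<open>F\<close>; class sums therefore count members of
  \<open>F\<close>.\<close>

lemma obtain_class_poly:
  obtains G where "bipoly s G"
    "\<And>p q. p \<le> card T \<Longrightarrow> q \<le> card (- T) \<Longrightarrow> even p \<Longrightarrow> even q \<Longrightarrow>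
      of_nat (card {S \<in> F. card (S \<inter> T) = p \<and> card (S - T) = q}) =
      of_nat ((card T choose p) * (card (- T) choose q)) * G (of_nat p) (of_nat q)"
proof -
  obtain G where G: "bipoly s G" "\<And>p q. p \<le> card T \<Longrightarrow> q \<le> card (- T) \<Longrightarrow>
      (\<Sum>S | card (S \<inter> T) = p \<and> card (S - T) = q. g S) =
      of_nat ((card T choose p) * (card (- T) choose q)) * G (of_nat p) (of_nat q)"
    using set_poly_class_sum[OF set_poly_g, of T] by blast
  show thesis
  proof (rule that[OF G(1)])
    fix p q assume pq: "p \<le> card T" "q \<le> card (- T)" "even p" "even q"
    have "g S = of_bool (S \<in> F)" if "card (S \<inter> T) = p" "card (S - T) = q" for S
    proof (rule g_eq)
      have "card S = p + q" using that card_Int_Diff[of S T] by simp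
      then show "even (card S)" using pq by simp
    qed
    then have "(\<Sum>S | card (S \<inter> T) = p \<and> card (S - T) = q. g S) =
        (\<Sum>S | card (S \<inter> T) = p \<and> card (S - T) = q. of_bool (S \<in> F))"
      by (intro sum.cong) auto
    also have "\<dots> = of_nat (card {S \<in> F. card (S \<inter> T) = p \<and> card (S - T) = q})"
    proof -
      have "{S. card (S \<inter> T) = p \<and> card (S - T) = q} \<inter> {S. S \<in> F} =
          {S \<in> F. card (S \<inter> T) = p \<and> card (S - T) = q}"
        by blast
      then show ?thesis by (subst sum_of_bool_eq) (rule finite, rule arg_cong)
    qed
    finally show "of_nat (card {S \<in> F. card (S \<inter> T) = p \<and> card (S - T) = q}) =
      of_nat ((card T choose p) * (card (- T) choose q)) * G (of_nat p) (of_nat q)"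
      using G(2)[OF pq(1,2)] by simp
  qed
qed

text \<open>With \<open>T\<close> empty, the proportion of members of \<open>F\<close> among the
  sets of even size \<open>q\<close> is a polynomial of degree at most \<open>s\<close>. It is 1 at
  0 and vanishes at \<open>2 * r\<close> for \<open>w < r \<le> w + s\<close>, since no member has
  more than \<open>2 * w\<close> elements; these \<open>s + 1\<close> conditions determine
  it.\<close>

lemma valency:
  "card {S \<in> F. card S = 2} * (w + s) = (CARD('n) choose 2) * w"
proof -
  let ?d = "w + s"
  obtain G where G: "bipoly s G" "\<And>p q. p \<le> card ({} :: 'n set) \<Longrightarrow> q \<le> card (- ({} :: 'n set)) \<Longrightarrow>
      even p \<Longrightarrow> even q \<Longrightarrow>
      of_nat (card {S \<in> F. card (S \<inter> {}) = p \<and> card (S - {}) = q}) =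
      of_nat ((card ({} :: 'n set) choose p) * (card (- ({} :: 'n set)) choose q)) *
        G (of_nat p) (of_nat q)"
    by (rule obtain_class_poly[of "{}"]) blast
  obtain P where P: "degree P \<le> s" "\<And>q. G 0 q = poly P q"
    using bipoly_section[OF G(1), of 0] by blast
  have count: "of_nat (card {S \<in> F. card S = q}) = of_nat (CARD('n) choose q) * poly P (of_nat q)"
    if "q \<le> CARD('n)" "even q" for q
    using G(2)[of 0 q] that P(2) by simp
  define D :: "complex poly" where "D = (\<Prod>r\<in>{Suc w..w + s}. [:1, - 1 / of_nat (2 * r):])"
  have "degree D \<le> card {Suc w..w + s}"
    unfolding D_def by (rule degree_prod_linear_le) auto
  then have degD: "degree D \<le> s" by simp
  have "P - D = 0"
  proof (rule poly_eq_0_many_roots)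
    let ?A = "insert 0 {Suc w..w + s}"
    show "poly (P - D) x = 0" if x: "x \<in> (\<lambda>r. of_nat (2 * r)) ` ?A" for x
    proof -
      obtain r where r: "x = of_nat (2 * r)" "r \<in> ?A" using x by blast
      show ?thesis
      proof (cases "r = 0")
        case True
        have "{S \<in> F. card S = 0} = {{}}" using empty_mem by auto
        then have "poly P 0 = 1" using count[of 0] by simp
        then show ?thesis using r True by (simp add: D_def poly_prod)
      next
        case False
        then have rw: "r \<in> {Suc w..w + s}" using r by simp
        then have none: "{S \<in> F. card S = 2 * r} = {}" using card_mem_le by fastforce
        have "2 * r \<le> CARD('n)" using rw le_card by simp
        then have "poly P x = 0" using count[of "2 * r", unfolded none] r by simp
        moreover have "poly D x = 0"
          unfolding D_def poly_prod using rw r by (intro prod_zero bexI[of _ r]) auto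
        ultimately show ?thesis by simp
      qed
    qed
    have "card ((\<lambda>r. of_nat (2 * r) :: complex) ` ?A) = Suc s"
      by (subst card_image) (auto simp: inj_on_def)
    moreover have "degree (P - D) \<le> s" using P(1) degD by (rule degree_diff_le)
    ultimately show "degree (P - D) < card ((\<lambda>r. of_nat (2 * r) :: complex) ` ?A)" by simp
  qed
  then have PD: "P = D" by simp
  \<comment> \<open>At 2 the factors are \<open>(r - 1) / r\<close>, so the product telescopes to
    \<open>w / (w + k)\<close>.\<close>
  have prod: "of_nat (w + k) * poly (\<Prod>r\<in>{Suc w..w + k}. [:1, - 1 / of_nat (2 * r):]) 2 =
      (of_nat w :: complex)" for k
  proof (induction k)
    case (Suc k)
    have "(of_nat (Suc (w + k)) :: complex) \<noteq> 0" by (rule of_nat_neq_0)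
    then show ?case
      using Suc.IH by (simp add: divide_simps del: of_nat_Suc) (simp add: algebra_simps)
  qed simp
  have "2 \<le> 2 * (w + s)" using w_pos by simp
  then have "2 \<le> CARD('n)" using le_card by (rule order_trans)
  then have "of_nat (card {S \<in> F. card S = 2} * ?d) =
      of_nat (CARD('n) choose 2) * (of_nat ?d * poly D 2)"
    using count[of 2] PD by simp
  also have "\<dots> = (of_nat ((CARD('n) choose 2) * w) :: complex)"
    unfolding D_def prod by simp
  finally show ?thesis by (simp only: of_nat_eq_iff)
qed

text \<open>For even \<open>p\<close> and \<open>q\<close>, \<open>G p q\<close> is the proportion
  of members among the sets with \<open>p\<close> elements inside \<open>T\<close> and
  \<open>q\<close> outside. Zeros forced by the distances to \<open>{}\<close> and \<open>T\<close>,
  and the value 1 at these two sets, make \<open>G\<close> agree with the polynomial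
  \<open>D\<close> in \<open>q\<close> on all lines \<open>p = 2 * i\<close> with
  \<open>i \<le> w\<close>. At \<open>q = 0\<close> the proportion is therefore 1.\<close>

lemma even_subset_mem:
  assumes T: "T \<in> F" "card T = 2 * w" and R: "R \<subseteq> T" "even (card R)"
  shows "R \<in> F"
proof -
  obtain G where G: "bipoly s G" and count: "\<And>p q. p \<le> card T \<Longrightarrow> q \<le> card (- T) \<Longrightarrow>
      even p \<Longrightarrow> even q \<Longrightarrow> of_nat (card {S \<in> F. card (S \<inter> T) = p \<and> card (S - T) = q}) =
      of_nat ((card T choose p) * (card (- T) choose q)) * G (of_nat p) (of_nat q)"
    by (rule obtain_class_poly[of T]) blast
  have cT: "card (- T) = CARD('n) - 2 * w"
    using T by (simp add: Compl_eq_Diff_UNIV card_Diff_subset)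
  define D :: "complex poly" where "D = (\<Prod>r\<in>{1..s}. [:1, - 1 / of_nat (2 * r):])"
  have "degree D \<le> card {1..s}"
    unfolding D_def by (rule degree_prod_linear_le) auto
  then have degD: "degree D \<le> s" by simp
  have D0: "poly D 0 = 1" by (simp add: D_def poly_prod)
  have Dr: "poly D (of_nat (2 * r)) = 0" if "0 < r" "r \<le> s" for r
    unfolding D_def poly_prod using that by (intro prod_zero bexI[of _ r]) auto
  define H where "H p q = G p q + - 1 * (poly 1 p * poly D q)" for p q
  have H: "bipoly s H"
    unfolding H_def using degD by (intro bipoly_add G bipoly_scale bipoly_mult) simp
  \<comment> \<open>A set of this class has symmetric differences of size \<open>p + q\<close> with
    \<open>{}\<close> and \<open>2 * w - p + q\<close> with \<open>T\<close>; one of these exceeds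
    \<open>2 * w\<close>.\<close>
  have G0: "G (of_nat p) (of_nat q) = 0"
    if "even p" "even q" "p \<le> 2 * w" "q \<le> 2 * s" "p < q \<or> 2 * w - p < q" for p q
  proof -
    have none: "{S \<in> F. card (S \<inter> T) = p \<and> card (S - T) = q} = {}"
    proof (intro equals0I)
      fix S assume "S \<in> {S \<in> F. card (S \<inter> T) = p \<and> card (S - T) = q}"
      then have S: "S \<in> F" "card (S \<inter> T) = p" "card (S - T) = q" by auto
      have "card S = p + q" using S card_Int_Diff[of S T] by simp
      moreover have "card (sym_diff S T) + 2 * p = card S + 2 * w"
        using card_sym_diff[of S T] S T by simp
      ultimately show False
        using card_mem_le[OF S(1)] card_sym_diff_le[OF S(1) T(1)] that by linarith
    qed
    have "q \<le> card (- T)" using that le_card cT by simp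
    then show ?thesis using count[of p q, unfolded none] that T by auto
  qed
  have G00: "G 0 0 = 1"
  proof -
    have "{S \<in> F. card (S \<inter> T) = 0 \<and> card (S - T) = 0} = {{}}"
      using empty_mem by auto
    then show ?thesis using count[of 0 0] by simp
  qed
  have Gw0: "G (of_nat (2 * w)) 0 = 1"
  proof -
    have "S = T" if "card (S \<inter> T) = 2 * w" "card (S - T) = 0" for S
    proof -
      have "S \<inter> T = T" using that T by (intro card_subset_eq) auto
      then show ?thesis using that by auto
    qed
    then have "{S \<in> F. card (S \<inter> T) = 2 * w \<and> card (S - T) = 0} = {T}"
      using T by auto
    then show ?thesis using count[of "2 * w" 0] T by simp
  qed
  have van: "H (of_nat (2 * i)) q = 0 \<and> H (of_nat (2 * w - 2 * i)) q = 0" if "2 * i \<le> w" for i q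
  proof (rule bipoly_vanishes[OF H w_pos _ _ _ that])
    fix i r assume ir: "2 * i \<le> w" "i < r" "r \<le> s"
    have "G (of_nat (2 * i)) (of_nat (2 * r)) = 0"
      using ir by (intro G0) auto
    moreover have "G (of_nat (2 * w - 2 * i)) (of_nat (2 * r)) = 0"
      using ir by (intro G0) auto
    ultimately show "H (of_nat (2 * i)) (of_nat (2 * r)) = 0 \<and>
        H (of_nat (2 * w - 2 * i)) (of_nat (2 * r)) = 0"
      using Dr[of r] ir by (simp add: H_def)
  qed (use G00 Gw0 D0 in \<open>simp_all add: H_def\<close>)
  define p where "p = card R"
  have p: "even p" "p \<le> 2 * w" using R T card_mono[of T R] by (auto simp: p_def)
  then obtain i where i: "p = 2 * i" by (elim evenE)
  have "H (of_nat p) 0 = 0"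
  proof (cases "2 * i \<le> w")
    case True
    then show ?thesis using van[of i 0] i by simp
  next
    case False
    then have "2 * (w - i) \<le> w" "p = 2 * w - 2 * (w - i)" using i p by auto
    then show ?thesis using van[of "w - i" 0] by simp
  qed
  then have "G (of_nat p) 0 = 1" using D0 by (simp add: H_def)
  then have "(of_nat (card {S \<in> F. card (S \<inter> T) = p \<and> card (S - T) = 0}) :: complex) =
      of_nat (card T choose p)"
    using count[of p 0] p T by simp
  then have "card {S \<in> F. card (S \<inter> T) = p \<and> card (S - T) = 0} = card T choose p"
    by (simp only: of_nat_eq_iff)
  also have "\<dots> = card {S. S \<subseteq> T \<and> card S = p}" by (simp add: n_subsets)
  finally have "{S \<in> F. card (S \<inter> T) = p \<and> card (S - T) = 0} = {S. S \<subseteq> T \<and> card S = p}"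
    by (intro card_subset_eq) (auto simp: Int_absorb2)
  then show ?thesis using R by (auto simp: p_def)
qed

end

section \<open>Classification\<close>

text \<open>Collects the results of the polynomial argument, which leaves a purely combinatorial
  classification. In \<open>convex\<close>, the sets \<open>sym_diff S R\<close> are the vertices on
  geodesics between \<open>S\<close> and \<open>T\<close>; neither end has to be \<open>{}\<close>,
  since the base vertex can be moved.\<close>

locale convex_family =
  fixes F :: "'n :: finite set set" and w d :: nat
  assumes even_card: "\<And>S. S \<in> F \<Longrightarrow> even (card S)"
    and card_sym_diff_le: "\<And>S R. S \<in> F \<Longrightarrow> R \<in> F \<Longrightarrow> card (sym_diff S R) \<le> 2 * w"
    and empty_mem: "{} \<in> F"
    and convex: "\<And>S T R. S \<in> F \<Longrightarrow> T \<in> F \<Longrightarrow> card (sym_diff S T) = 2 * w \<Longrightarrow>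
      R \<subseteq> sym_diff S T \<Longrightarrow> even (card R) \<Longrightarrow> sym_diff S R \<in> F"
    and valency: "card {S \<in> F. card S = 2} * d = (CARD('n) choose 2) * w"
    and width_attained: "\<exists>T\<in>F. card T = 2 * w"
    and w_pos: "1 \<le> w" and w_less: "w < d" and d_ge: "3 \<le> d"
    and card_UNIV: "CARD('n) = 2 * d \<or> CARD('n) = 2 * d + 1"
begin

lemma card_edges:
  "card {S \<in> F. card S = 2} = w * (if CARD('n) = 2 * d then 2 * d - 1 else 2 * d + 1)"
proof -
  have "CARD('n) choose 2 = d * (if CARD('n) = 2 * d then 2 * d - 1 else 2 * d + 1)"
    using card_UNIV by (auto simp: choose_two)
  then have "card {S \<in> F. card S = 2} * d =
      w * (if CARD('n) = 2 * d then 2 * d - 1 else 2 * d + 1) * d"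
    using valency by (simp add: mult_ac)
  then show ?thesis using d_ge mult_cancel2[of _ d] by simp
qed

text \<open>Distinct edges at \<open>{}\<close> intersect, so they form a star or a triangle; there are too many
  of them for a triangle.\<close>

lemma width_one:
  assumes "w = 1"
  shows "CARD('n) = 2 * d \<and> (\<exists>b. F = {S. card (sym_diff S {b}) = 1})"
proof -
  define Ed where "Ed = {S \<in> F. card S = 2}"
  have card_Ed: "card Ed = (if CARD('n) = 2 * d then 2 * d - 1 else 2 * d + 1)"
    using card_edges assms by (simp add: Ed_def)
  have meet: "S \<inter> R \<noteq> {}" if "S \<in> Ed" "R \<in> Ed" for S R
  proof
    assume "S \<inter> R = {}"
    then have "card (sym_diff S R) = 4"
      using card_sym_diff[of S R] that by (simp add: Ed_def)
    then show False using card_sym_diff_le[of S R] that assms by (simp add: Ed_def)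
  qed
  have "\<not> card Ed \<le> Suc 0" using card_Ed d_ge by (auto split: if_splits)
  then obtain A B where AB: "A \<in> Ed" "B \<in> Ed" "A \<noteq> B"
    by (auto simp: card_le_Suc0_iff_eq)
  then obtain b where b: "b \<in> A" "b \<in> B" using meet by blast
  have "card (A - {b}) = 1" "card (B - {b}) = 1" using AB b by (auto simp: Ed_def)
  then obtain c c' where "A - {b} = {c}" "B - {b} = {c'}" by (auto simp: card_1_singleton_iff)
  then have A: "A = {b, c}" and B: "B = {b, c'}" and ne: "c \<noteq> b" "c' \<noteq> b" "c \<noteq> c'"
    using b AB by auto
  have star: "b \<in> S" if S: "S \<in> Ed" for S
  proof (rule ccontr)
    assume "b \<notin> S"
    \<comment> \<open>The only edge that avoids \<open>b\<close> but meets \<open>A\<close> and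
      \<open>B\<close> is \<open>{c, c'}\<close>. If it occurs, all edges lie in the triangle on
      \<open>b\<close>, \<open>c\<close>, \<open>c'\<close>, so there are at most 3, whereas the
      valency is at least 5.\<close>
    then have "{c, c'} \<subseteq> S" using meet[OF S AB(1)] meet[OF S AB(2)] A B by auto
    moreover have "card {c, c'} = card S" using ne S by (simp add: Ed_def)
    ultimately have Sc: "S = {c, c'}" by (metis card_subset_eq finite)
    have "R \<subseteq> {b, c, c'} \<and> card R = 2" if R: "R \<in> Ed" for R
    proof -
      have "\<exists>K. K \<subseteq> R \<and> K \<subseteq> {b, c, c'} \<and> card K = 2"
      proof (cases "b \<in> R")
        case True
        obtain e where e: "e \<in> R" "e \<in> {c, c'}" using meet[OF R S] Sc by auto
        then show ?thesis using True ne by (intro exI[of _ "{b, e}"]) auto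
      next
        case False
        then have "c \<in> R" "c' \<in> R" using meet[OF R AB(1)] meet[OF R AB(2)] A B by auto
        then show ?thesis using ne by (intro exI[of _ "{c, c'}"]) auto
      qed
      then show ?thesis
        using R card_subset_eq[of R] by (auto simp: Ed_def)
    qed
    then have "Ed \<subseteq> {R. R \<subseteq> {b, c, c'} \<and> card R = 2}" by blast
    then have "card Ed \<le> card {R. R \<subseteq> {b, c, c'} \<and> card R = 2}" by (intro card_mono) auto
    also have "\<dots> = card {b, c, c'} choose 2" by (rule n_subsets) simp
    also have "\<dots> = 3" using ne by (simp add: choose_two)
    finally show False using card_Ed d_ge by (auto split: if_splits)
  qed
  have sub: "Ed \<subseteq> (\<lambda>j. {b, j}) ` (- {b})"
  proof
    fix S assume S: "S \<in> Ed"
    then have "card (S - {b}) = 1" using star by (simp add: Ed_def)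
    then obtain j where "S - {b} = {j}" by (auto simp: card_1_singleton_iff)
    then have "S = {b, j}" "j \<noteq> b" using star[OF S] by auto
    then show "S \<in> (\<lambda>j. {b, j}) ` (- {b})" by blast
  qed
  have card_star: "card ((\<lambda>j. {b, j}) ` (- {b})) = CARD('n) - 1"
    by (subst card_image) (auto simp: inj_on_def doubleton_eq_iff Compl_eq_Diff_UNIV)
  \<comment> \<open>The star has \<open>CARD('n) - 1\<close> edges, which rules out
    \<open>CARD('n) = 2 * d + 1\<close> with its valency \<open>2 * d + 1\<close>; for
    \<open>CARD('n) = 2 * d\<close> every edge of the star occurs.\<close>
  have "card Ed \<le> CARD('n) - 1"
    using card_mono[OF _ sub] card_star by simp
  then have n: "CARD('n) = 2 * d" using card_Ed card_UNIV by (auto split: if_splits)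
  have Ed: "Ed = (\<lambda>j. {b, j}) ` (- {b})"
    using sub card_Ed card_star n by (intro card_subset_eq) auto
  have "F = {S. card (sym_diff S {b}) = 1}"
  proof (intro set_eqI iffI)
    fix S assume S: "S \<in> F"
    show "S \<in> {S. card (sym_diff S {b}) = 1}"
    proof (cases "S = {}")
      case False
      then have "card S \<noteq> 0" "card S \<le> 2" "even (card S)"
        using S card_sym_diff_le[OF S empty_mem] even_card assms by auto
      then have "card S = 2" by presburger
      then have "S \<in> Ed" using S by (simp add: Ed_def)
      then obtain j where "S = {b, j}" "j \<noteq> b" using Ed by auto
      then have "sym_diff S {b} = {j}" by auto
      then show ?thesis by simp
    qed simp
  next
    fix S assume "S \<in> {S. card (sym_diff S {b}) = 1}"
    then obtain j where j: "sym_diff S {b} = {j}" by (auto simp: card_1_singleton_iff)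
    show "S \<in> F"
    proof (cases "j = b")
      case True
      then have "S = {}" using j by blast
      then show ?thesis using empty_mem by simp
    next
      case False
      then have "S = {b, j}" using j by blast
      then have "S \<in> Ed" using False Ed by blast
      then show ?thesis by (simp add: Ed_def)
    qed
  qed
  then show ?thesis using n by blast
qed

text \<open>One edge \<open>{a, b}\<close> leaving \<open>T\<close> forces all even subsets of
  \<open>insert a T\<close> into \<open>F\<close>, and two such coordinates \<open>a\<close> would
  produce members too far apart. The edges at \<open>{}\<close> thus lie within
  \<open>2 * w + 1\<close> coordinates, and their number leaves only \<open>w = d - 1\<close>, with
  a single coordinate left over.\<close>

lemma width_ge_two:
  assumes "2 \<le> w"
  shows "CARD('n) = 2 * d \<and> w = d - 1 \<and> (\<exists>i. F = {S. even (card S) \<and> i \<notin> S})"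
proof -
  obtain T where T: "T \<in> F" "card T = 2 * w" using width_attained by blast
  have sub_T: "U \<in> F" if "U \<subseteq> T" "even (card U)" for U
    using convex[OF empty_mem T(1), of U] that T(2) by simp
  \<comment> \<open>The members \<open>{a, b}\<close> and \<open>T - {b, c}\<close> differ exactly
    in \<open>insert a (T - {c})\<close>, a set of size \<open>2 * w\<close>, so convexity applies
    to them.\<close>
  have exchange: "U \<in> F"
    if a: "a \<notin> T" and bc: "b \<in> T" "c \<in> T" "b \<noteq> c" and ab: "{a, b} \<in> F"
      and U: "U \<subseteq> insert a (T - {c})" "even (card U)" for a b c U
  proof -
    have eq: "sym_diff {a, b} (T - {b, c}) = insert a (T - {c})"
      using a bc by auto
    have "card (T - {b, c}) = 2 * w - 2" using bc T by (simp add: card_Diff_subset)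
    then have "T - {b, c} \<in> F" by (intro sub_T) auto
    moreover have "card (insert a (T - {c})) = 2 * w" using a bc T assms by simp
    moreover have "card (sym_diff {a, b} U) + 2 * card ({a, b} \<inter> U) = card {a, b} + card U"
      by (rule card_sym_diff) auto
    then have "even (card (sym_diff {a, b} U))"
      using U(2) even_card[OF ab] by presburger
    moreover have "sym_diff {a, b} U \<subseteq> insert a (T - {c})" using U bc by blast
    ultimately have "sym_diff {a, b} (sym_diff {a, b} U) \<in> F"
      using convex[OF ab, of "T - {b, c}" "sym_diff {a, b} U"] eq by simp
    moreover have "sym_diff {a, b} (sym_diff {a, b} U) = U" by blast
    ultimately show ?thesis by simp
  qed
  have extend: "U \<in> F"
    if a: "a \<notin> T" and b: "b \<in> T" and ab: "{a, b} \<in> F"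
      and U: "U \<subseteq> insert a T" "even (card U)" for a b U
  proof (cases "a \<in> U")
    case False
    then show ?thesis using U sub_T by blast
  next
    case True
    have "U \<noteq> insert a T" using U(2) a T by auto
    then obtain c where c: "c \<in> T" "c \<notin> U" using U True by blast
    show ?thesis
    proof (cases "c = b")
      case False
      then show ?thesis using exchange[OF a b c(1) _ ab] U c by blast
    next
      case True
      \<comment> \<open>When \<open>U\<close> misses \<open>b\<close> itself, the edge is first
        replaced by \<open>{a, b'}\<close>. This takes two further points of \<open>T\<close>,
        available because \<open>w\<close> is at least 2.\<close>
      have "\<not> card (T - {b}) \<le> Suc 0" using T b assms by simp
      then obtain e b' where e: "e \<in> T" "b' \<in> T" "e \<noteq> b" "b' \<noteq> b" "e \<noteq> b'"
        by (auto simp: card_le_Suc0_iff_eq)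
      have "a \<noteq> b'" using a e by blast
      then have "card {a, b'} = 2" by simp
      then have "{a, b'} \<in> F"
        using exchange[OF a b e(1) _ ab, of "{a, b'}"] e by auto
      then show ?thesis using exchange[OF a e(2) c(1)] True U c e by blast
    qed
  qed
  have unique: "a = a'"
    if a: "a \<notin> T" "a' \<notin> T" and b: "b \<in> T" "b' \<in> T" and ab: "{a, b} \<in> F" "{a', b'} \<in> F"
    for a a' b b'
  proof (rule ccontr)
    assume "a \<noteq> a'"
    \<comment> \<open>By \<open>extend\<close> this set is a member, but it differs from
      \<open>{a, b}\<close> in all of \<open>insert a (insert a' T)\<close>, which has
      \<open>2 * w + 2\<close> elements.\<close>
    have "card (insert a' (T - {b})) = 2 * w" using a b T assms by simp
    then have "insert a' (T - {b}) \<in> F"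
      using extend[OF a(2) b(2) ab(2), of "insert a' (T - {b})"] by auto
    moreover have "sym_diff {a, b} (insert a' (T - {b})) = insert a (insert a' T)"
      using a b \<open>a \<noteq> a'\<close> by auto
    ultimately have "card (insert a (insert a' T)) \<le> 2 * w"
      using card_sym_diff_le[OF ab(1)] by metis
    then show False using a T \<open>a \<noteq> a'\<close> by simp
  qed
  have edge: "S \<subseteq> T \<or> (\<exists>a b. a \<notin> T \<and> b \<in> T \<and> S = {a, b})" if S: "S \<in> F" "card S = 2" for S
  proof -
    have "S \<inter> T \<noteq> {}"
      using card_sym_diff[of S T] card_sym_diff_le[OF S(1) T(1)] S T by auto
    moreover obtain p q where "S = {p, q}" "p \<noteq> q" using S(2) by (auto simp: card_2_iff)
    ultimately show ?thesis by auto
  qed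
  have bound: "w * (if CARD('n) = 2 * d then 2 * d - 1 else 2 * d + 1) \<le> card B choose 2"
    if "\<And>S. S \<in> F \<Longrightarrow> card S = 2 \<Longrightarrow> S \<subseteq> B" for B
  proof -
    have "card {S \<in> F. card S = 2} \<le> card {S. S \<subseteq> B \<and> card S = 2}"
      using that by (intro card_mono) auto
    then show ?thesis by (simp add: card_edges n_subsets)
  qed
  \<comment> \<open>Edges inside \<open>T\<close> number at most \<open>w * (2 * w - 1)\<close>,
    fewer than the valency since \<open>w < d\<close>.\<close>
  have "\<exists>a b. a \<notin> T \<and> b \<in> T \<and> {a, b} \<in> F"
  proof (rule ccontr)
    assume "\<not> ?thesis"
    then have "w * (if CARD('n) = 2 * d then 2 * d - 1 else 2 * d + 1) \<le> card T choose 2"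
      using edge by (intro bound) blast
    also have "card T choose 2 = w * (2 * w - 1)" using T by (simp add: choose_two)
    finally have "(if CARD('n) = 2 * d then 2 * d - 1 else 2 * d + 1) \<le> 2 * w - 1"
      using w_pos by (subst (asm) mult_le_cancel1) simp
    then show False using w_less by (auto split: if_splits)
  qed
  then obtain a b where a: "a \<notin> T" and b: "b \<in> T" and ab: "{a, b} \<in> F" by blast
  have card_aT: "card (insert a T) = 2 * w + 1" using a T by simp
  have "w * (if CARD('n) = 2 * d then 2 * d - 1 else 2 * d + 1) \<le> card (insert a T) choose 2"
  proof (rule bound)
    fix S assume S: "S \<in> F" "card S = 2"
    then show "S \<subseteq> insert a T" using edge[OF S] unique[OF a _ b _ ab] by blast
  qed
  also have "card (insert a T) choose 2 = w * (2 * w + 1)"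
    unfolding card_aT by (simp add: choose_two)
  \<comment> \<open>As \<open>w < d\<close>, the value \<open>2 * d + 1\<close> is impossible and
    \<open>2 * d - 1\<close> forces \<open>w = d - 1\<close>.\<close>
  finally have "(if CARD('n) = 2 * d then 2 * d - 1 else 2 * d + 1) \<le> 2 * w + 1"
    using w_pos by (subst (asm) mult_le_cancel1) simp
  then have n: "CARD('n) = 2 * d" and w: "w = d - 1"
    using w_less by (auto split: if_splits)
  have "card (- insert a T) = 1"
    using card_aT n w d_ge by (simp only: Compl_eq_Diff_UNIV card_Diff_subset finite subset_UNIV)
  then obtain i where "- insert a T = {i}" by (rule card_1_singletonE)
  then have i: "insert a T = - {i}" by (metis double_complement)
  have mem: "U \<in> F" if "even (card U)" "i \<notin> U" for U
    using extend[OF a b ab, of U] that unfolding i by blast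
  have "F = {S. even (card S) \<and> i \<notin> S}"
  proof (intro set_eqI iffI)
    fix S assume S: "S \<in> F"
    \<comment> \<open>The complement of a member containing \<open>i\<close> would be an even set
      avoiding \<open>i\<close>, hence a member at distance \<open>d\<close> from it.\<close>
    have "i \<notin> S"
    proof
      assume "i \<in> S"
      have "card (- S) = 2 * d - card S"
        by (simp add: Compl_eq_Diff_UNIV card_Diff_subset n)
      then have "- S \<in> F" using even_card[OF S] \<open>i \<in> S\<close> by (intro mem) auto
      moreover have "sym_diff S (- S) = UNIV" by blast
      ultimately have "2 * d \<le> 2 * w" using card_sym_diff_le[OF S, of "- S"] n by simp
      then show False using w_less by simp
    qed
    then show "S \<in> {S. even (card S) \<and> i \<notin> S}" using even_card[OF S] by simp
  qed (use mem in blast)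
  then show ?thesis using n w by blast
qed

end

section \<open>From vertices to families of coordinate sets\<close>

lemma flip_flip: "flip (flip x S) R = flip x (sym_diff S R)"
proof -
  have "(b :: bit) + 1 + 1 = b" for b by (cases b) auto
  then show ?thesis by (auto simp: flip_def vec_eq_iff)
qed

text \<open>Any vertex of \<open>Y\<close> may serve as base vertex \<open>x\<close>; this freedom
  later gives convexity between two arbitrary members at maximal distance.\<close>

lemma width_family_flip:
  fixes x :: "bit ^ 'n"
  assumes n: "CARD('n) = 2 * d \<or> CARD('n) = 2 * d + 1"
    and std: "standard_ordering (halved_cube_vertices \<epsilon>) (halved_cube_adj \<epsilon>) d 1 \<alpha> \<beta> E"
    and desc: "nontrivial_descendent (halved_cube_vertices \<epsilon>) (halved_cube_adj \<epsilon>) E Y"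
    and x: "x \<in> Y"
  shows "\<exists>g. width_family {S. flip x S \<in> Y} g
    (width (halved_cube_vertices \<epsilon>) (halved_cube_adj \<epsilon>) Y)
    (dual_width (halved_cube_vertices \<epsilon>) (halved_cube_adj \<epsilon>) E Y)"
proof -
  let ?V = "halved_cube_vertices \<epsilon> :: (bit ^ 'n) set" and ?adj = "halved_cube_adj \<epsilon>"
  let ?w = "width ?V ?adj Y" and ?s = "dual_width ?V ?adj E Y"
  interpret bose_mesner_algebra ?V ?adj by (rule bose_mesner_algebra_halved_cube)
  have diam: "diam ?V ?adj = d" using n by (auto simp: halved_cube_diam)
  have Y: "Y \<subseteq> ?V" and w: "?w \<noteq> 0" "?w + ?s = d"
    using desc diam by (auto simp: nontrivial_descendent_def descendent_def)
  obtain \<theta> \<xi> \<zeta> where Q: "Q_polynomial ?V ?adj E" and \<theta>: "dual_eigenvalues ?V ?adj E \<theta>"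
    and \<xi>: "\<xi> \<noteq> 0" and lin: "\<forall>i\<le>d. \<theta> i = \<xi> * of_real (q_int 1 (d - i)) + \<zeta>"
    using std unfolding standard_ordering_def by blast
  have lin': "\<theta> i = \<xi> * of_nat (diam ?V ?adj - i) + \<zeta>" if "i \<le> diam ?V ?adj" for i
    using lin that by (simp add: diam q_int_def)
  obtain P :: "complex poly" where P: "degree P \<le> ?s"
    "\<And>z. z \<in> ?V \<Longrightarrow> of_bool (z \<in> Y) = (\<Sum>y\<in>Y. poly P (of_nat (gdist ?adj z y)))"
    using indicator_eq_sum_poly_gdist[OF Q \<theta> lin' \<xi> Y quad_form_above_dual_width[of E Y]] by blast
  have xV: "x \<in> ?V" using x Y by blast
  have V: "flip x S \<in> ?V \<longleftrightarrow> even (card S)" for S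
    using even_card_diff_set[OF xV] by (simp add: diff_set_flip)
  show ?thesis
  proof (intro exI, unfold_locales)
    \<comment> \<open>The formula makes sense for all \<open>S\<close>; for even \<open>S\<close>,
      half the size is a distance and the sum is the indicator of \<open>Y\<close>.\<close>
    show "set_poly ?s (\<lambda>S. \<Sum>y\<in>Y. poly P (of_nat (card (sym_diff S (diff_set x y))) / 2))"
      using finite_subset[OF Y finite_V] by (intro set_poly_sum set_poly_poly_card_sym_diff P)
    fix S :: "'n set" assume S: "even (card S)"
    have "poly P (of_nat (card (sym_diff S (diff_set x y))) / 2) =
        poly P (of_nat (gdist ?adj (flip x S) y))" if "y \<in> Y" for y
    proof -
      have "card (sym_diff S (diff_set x y)) = 2 * gdist ?adj (flip x S) y"
        using gdist_halved_cube[of "flip x S" \<epsilon> y] V S that Y by (auto simp: diff_set_flip_left)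
      then show ?thesis by simp
    qed
    then show "(\<Sum>y\<in>Y. poly P (of_nat (card (sym_diff S (diff_set x y))) / 2)) =
        of_bool (S \<in> {S. flip x S \<in> Y})"
      using P(2)[of "flip x S"] V S by simp
  next
    fix S assume "S \<in> {S. flip x S \<in> Y}"
    then show "even (card S)" using V Y by blast
  next
    fix S R assume SR: "S \<in> {S. flip x S \<in> Y}" "R \<in> {S. flip x S \<in> Y}"
    then have "gdist ?adj (flip x S) (flip x R) \<le> ?w"
      by (intro gdist_le_width Y) auto
    moreover have "2 * gdist ?adj (flip x S) (flip x R) = card (sym_diff S R)"
      using gdist_halved_cube[of "flip x S" \<epsilon> "flip x R"] SR Y
      by (auto simp: diff_set_flip_left diff_set_flip)
    ultimately show "card (sym_diff S R) \<le> 2 * ?w" by simp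
  next
    show "{} \<in> {S. flip x S \<in> Y}"
      using x flip_diff_set[of x x] by (simp add: diff_set_empty[THEN iffD2])
    show "1 \<le> ?w" using w by simp
    show "2 * (?w + ?s) \<le> CARD('n)" using n w by auto
  qed
qed

theorem mainTheorem11:
  fixes d w :: nat and \<epsilon> :: bit
    and X :: "(bit ^ 'n) set"
    and E :: "nat \<Rightarrow> (bit ^ 'n) matrix"
    and Y :: "(bit ^ 'n) set"
  assumes "d \<ge> 3"
    and "CARD('n) = 2 * d \<or> CARD('n) = 2 * d + 1"
    and "X = halved_cube_vertices \<epsilon>"
    and "standard_ordering X (halved_cube_adj \<epsilon>) d 1 2
           (if CARD('n) = 2 * d then 2 * real d - 1 else 2 * real d + 1) E"
    and "nontrivial_descendent X (halved_cube_adj \<epsilon>) E Y"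
    and "w = width X (halved_cube_adj \<epsilon>) Y"
  shows "CARD('n) = 2 * d \<and>
    ((w = 1 \<and> (\<exists>z \<in> halved_cube_vertices (1 + \<epsilon>). Y = {x \<in> X. wt (x - z) = 1})) \<or>
     (w = d - 1 \<and> (\<exists>(a :: bit) (i :: 'n). Y = {x \<in> X. x $ i = a})))"
proof -
  interpret bose_mesner_algebra X "halved_cube_adj \<epsilon>"
    unfolding assms(3) by (rule bose_mesner_algebra_halved_cube)
  let ?s = "dual_width X (halved_cube_adj \<epsilon>) E Y"
  have diam: "diam X (halved_cube_adj \<epsilon>) = d"
    using assms(2) by (auto simp: assms(3) halved_cube_diam)
  have Y: "Y \<subseteq> X" "Y \<noteq> {}" and ws: "w + ?s = d" "w \<noteq> d"
    using assms(5,6) diam by (auto simp: nontrivial_descendent_def descendent_def)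
  have fam: "\<exists>g. width_family {S. flip x S \<in> Y} g w ?s" if "x \<in> Y" for x
    unfolding assms(3,6)
    by (rule width_family_flip[OF assms(2) assms(4)[unfolded assms(3)]
          assms(5)[unfolded assms(3)] that])
  obtain x y where x: "x \<in> Y" and y: "y \<in> Y" and xy: "gdist (halved_cube_adj \<epsilon>) x y = w"
    unfolding assms(6) by (rule width_attained[OF Y])
  have xX: "x \<in> X" using x Y by blast
  obtain g where "width_family {S. flip x S \<in> Y} g w ?s" using fam[OF x] by blast
  then interpret width_family "{S. flip x S \<in> Y}" g w ?s .
  have "convex_family {S. flip x S \<in> Y} w d"
  proof
    fix S T R
    assume S: "S \<in> {S. flip x S \<in> Y}" and T: "T \<in> {S. flip x S \<in> Y}"
      and "card (sym_diff S T) = 2 * w" "R \<subseteq> sym_diff S T" "even (card R)"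
    \<comment> \<open>Seen from the base vertex \<open>flip x S\<close>, the set \<open>T\<close>
      becomes \<open>sym_diff S T\<close>, a member of maximal size \<open>2 * w\<close>.\<close>
    obtain h where h: "width_family {R. flip (flip x S) R \<in> Y} h w ?s" using fam S by blast
    have "flip (flip x S) (sym_diff S T) \<in> Y"
    proof -
      have "sym_diff S (sym_diff S T) = T" by blast
      then show ?thesis using T by (simp add: flip_flip)
    qed
    then have "flip (flip x S) R \<in> Y"
      using width_family.even_subset_mem[OF h, of "sym_diff S T" R]
        \<open>card (sym_diff S T) = 2 * w\<close> \<open>R \<subseteq> sym_diff S T\<close> \<open>even (card R)\<close> by simp
    then show "sym_diff S R \<in> {S. flip x S \<in> Y}" by (simp add: flip_flip)
  next
    have "card (diff_set x y) = 2 * w"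
      using gdist_halved_cube[of x \<epsilon> y] xX y Y xy assms(3) by auto
    then show "\<exists>T\<in>{S. flip x S \<in> Y}. card T = 2 * w"
      using y by (intro bexI[of _ "diff_set x y"]) (auto simp: flip_diff_set)
  next
    have "d = w + ?s" using ws by simp
    then show "card {S \<in> {S. flip x S \<in> Y}. card S = 2} * d = (CARD('n) choose 2) * w"
      using valency by simp
    show "w < d" using ws by simp
  qed (fact even_card card_sym_diff_le empty_mem w_pos assms(1,2))+
  then interpret convex_family "{S. flip x S \<in> Y}" w d .
  have mem: "v \<in> Y \<longleftrightarrow> diff_set x v \<in> A" if "{S. flip x S \<in> Y} = A" for v A
    unfolding that[symmetric] by (simp add: flip_diff_set)
  show ?thesis
  proof (cases "w = 1")
    case True
    obtain b where n: "CARD('n) = 2 * d"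
      and b: "{S. flip x S \<in> Y} = {S. card (sym_diff S {b}) = 1}"
      using width_one[OF True] by blast
    \<comment> \<open>Flipping the centre \<open>b\<close> of the star gives the common neighbour
      \<open>?z\<close> of \<open>Y\<close> in the full cube, which lies in the other parity
      class.\<close>
    let ?z = "flip x {b}"
    have "?z \<notin> halved_cube_vertices \<epsilon>"
      using even_card_diff_set[of x \<epsilon> ?z] xX assms(3) by (simp add: diff_set_flip)
    then have z: "?z \<in> halved_cube_vertices (1 + \<epsilon>)"
      by (cases \<epsilon>) (auto simp: halved_cube_vertices_def)
    have "wt (v - ?z) = card (sym_diff (diff_set x v) {b})" for v
      using diff_set_sym_diff[of v ?z x] by (simp add: wt_diff diff_set_flip diff_set_commute)
    then have "v \<in> Y \<longleftrightarrow> wt (v - ?z) = 1" for v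
      by (simp add: mem[OF b])
    then have "Y = {v \<in> X. wt (v - ?z) = 1}"
      using Y(1) by blast
    then show ?thesis using True n z by blast
  next
    case False
    then have "2 \<le> w" using w_pos by simp
    from width_ge_two[OF this] obtain i where n: "CARD('n) = 2 * d" and w: "w = d - 1"
      and i: "{S. flip x S \<in> Y} = {S. even (card S) \<and> i \<notin> S}"
      by blast
    \<comment> \<open>Avoiding \<open>i\<close> means keeping the coordinate of the base vertex
      there, so the witness for \<open>a\<close> is \<open>x $ i\<close>.\<close>
    have "v \<in> X \<longleftrightarrow> even (card (diff_set x v))" for v
      using even_card_diff_set[of x \<epsilon> v] xX assms(3) by simp
    moreover have "i \<notin> diff_set x v \<longleftrightarrow> v $ i = x $ i" for v
      by (auto simp: diff_set_def)
    ultimately have "Y = {v \<in> X. v $ i = x $ i}"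
      by (intro set_eqI) (simp add: mem[OF i])
    then show ?thesis using n w by blast
  qed
qed

end
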